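(* Let $(\overline M,\overline\varphi,\overline\xi,\overline\eta,g)$ be an almost contact manifold with Norden metric, $\dim\overline M=2n+3$, and let $M$ be a submanifold of $\overline M$ of codimension $2$. Assume there are normal vector fields $N_1,N_2$ defined globally on $M$, spanning the normal space $\alpha=(T_pM)^\perp$ at each $p\in M$, such that: (i) $g(N_1,N_1)=-g(N_2,N_2)=1$ and $g(N_1,N_2)=0$; (ii) $g(N_i,\overline\varphi N_j)=0$ for all $i,j\in\{1,2\}$; (iii) $\alpha$ is orthogonal to $\overline\xi$, i.e. $\overline\xi\in T_pM$ at every $p\in M$. Define vector fields $\xi_0,\xi_1,\xi_2$ on $M$, $1$-forms $\eta^1,\eta^2$ on $M$ and a $(1,1)$-tensor field $\varphi$ on $M$ by the decompositions into tangential and normal parts $$\overline\xi=\xi_0,\qquad \overline\varphi X=\varphi X+\eta^1(X)N_1+\eta^2(X)N_2,\qquad \overline\varphi N_1=\xi_1,\qquad \overline\varphi N_2=-\xi_2,$$ for vector fields $X$ on $M$, and put $\eta^0(X)=g(X,\xi_0)$. Let $t_0,t_2$ be functions on $M$ with $t_0^2+t_2^2=1$, and define on $M$ $$\xi=t_0\xi_0-t_2\xi_2,\qquad \eta(X)=t_0\eta^0(X)-t_2\eta^2(X),$$ $$\phi X=\varphi X+t_0\{\eta^1(X)\xi_2+\eta^2(X)\xi_1\}+t_2\{\eta^0(X)\xi_1+\eta^1(X)\xi_0\}.$$ Then $(\phi,\xi,\eta)$ is an almost contact structure on $M$ and the restriction of $g$ to $M$ is a Norden metric for it; that is, $(M,\phi,\xi,\eta,g)$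 is a $(2n+1)$-dimensional almost contact manifold with Norden metric.
   Context: All manifolds, tensor fields, functions are smooth. An almost contact manifold with Norden metric $(M,\varphi,\xi,\eta,g)$ of dimension $2m+1$ is a manifold with a $(1,1)$-tensor field $\varphi$, a vector field $\xi$, a $1$-form $\eta$ and a pseudo-Riemannian metric $g$ such that $(\varphi,\xi,\eta)$ is an almost contact structure, i.e. $\varphi^2=-\mathrm{id}+\eta\otimes\xi$ and $\eta(\xi)=1$, and $g$ is a Norden metric, i.e. $g(\varphi X,\varphi Y)=-g(X,Y)+\eta(X)\eta(Y)$ for all vector fields $X,Y$. Such a metric is indefinite of signature $(m+1,m)$. The restriction of $g$ to the submanifold is denoted by the same letter $g$. Normal spaces are taken with respect to $g$; under (ii), $\overline\varphi N_1$ and $\overline\varphi N_2$ are tangent to $M$, so $\xi_1,\xi_2$ are vector fields on $M$. *)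

theory Defs
  imports "HOL-Analysis.Analysis" "HOL-Library.Function_Algebras"
begin

section \<open>Functions into a real vector space form a real vector space\<close>

instantiation "fun" :: (type, scaleR) scaleR
begin

definition scaleR_fun :: "real \<Rightarrow> ('a \<Rightarrow> 'b) \<Rightarrow> 'a \<Rightarrow> 'b" where
  "scaleR_fun r f = (\<lambda>x. r *\<^sub>R f x)"

instance ..

end

lemma scaleR_fun_apply [simp]: "(r *\<^sub>R f) x = r *\<^sub>R f x"
  by (simp add: scaleR_fun_def)

instance "fun" :: (type, real_vector) real_vector
  by standard (simp_all add: fun_eq_iff scaleR_add_right scaleR_add_left)


section \<open>Smooth functions between Euclidean spaces\<close>

text \<open>These notions are only used for open sets \<open>S\<close>.\<close>

primrec Ck_on ::
    "nat \<Rightarrow> 'e set \<Rightarrow> ('e::euclidean_space \<Rightarrow> 'f::real_normed_vector) \<Rightarrow> bool" where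
  "Ck_on 0 S f \<longleftrightarrow> continuous_on S f"
| "Ck_on (Suc k) S f \<longleftrightarrow>
     (\<forall>x\<in>S. f differentiable (at x)) \<and>
     (\<forall>v. Ck_on k S (\<lambda>x. frechet_derivative f (at x) v))"

definition smooth_on :: "'e set \<Rightarrow> ('e::euclidean_space \<Rightarrow> 'f::real_normed_vector) \<Rightarrow> bool" where
  "smooth_on S f \<longleftrightarrow> (\<forall>k. Ck_on k S f)"


section \<open>Smooth manifolds\<close>

text \<open>
  A chart is a pair of a domain and a coordinate map; the values of the coordinate map outside
  the domain are irrelevant. An atlas determines the smooth structure and need not be maximal.
  The dimension of the manifold is the dimension of the model space \<open>'e\<close>.
\<close>

type_synonym ('a, 'e) chart = "'a set \<times> ('a \<Rightarrow> 'e)"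

record ('a, 'e) manifold =
  mtop :: "'a topology"
  atlas :: "('a, 'e) chart set"

definition points :: "('a, 'e) manifold \<Rightarrow> 'a set" where
  "points M = topspace (mtop M)"

definition charts_at :: "('a, 'e) manifold \<Rightarrow> 'a \<Rightarrow> ('a, 'e) chart set" where
  "charts_at M p = {c \<in> atlas M. p \<in> fst c}"

definition chart_inv :: "('a, 'e) chart \<Rightarrow> 'e \<Rightarrow> 'a" where
  "chart_inv c = inv_into (fst c) (snd c)"

definition transition :: "('a, 'e) chart \<Rightarrow> ('a, 'e) chart \<Rightarrow> 'e \<Rightarrow> 'e" where
  "transition c d = snd d \<circ> chart_inv c"

definition smooth_manifold :: "('a, 'e::euclidean_space) manifold \<Rightarrow> bool" where
  "smooth_manifold M \<longleftrightarrow>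
     Hausdorff_space (mtop M) \<and> second_countable (mtop M) \<and>
     (\<forall>c\<in>atlas M. openin (mtop M) (fst c) \<and> open (snd c ` fst c) \<and>
        homeomorphic_map (subtopology (mtop M) (fst c)) (top_of_set (snd c ` fst c)) (snd c)) \<and>
     (\<Union>c\<in>atlas M. fst c) = points M \<and>
     (\<forall>c\<in>atlas M. \<forall>d\<in>atlas M. smooth_on (snd c ` (fst c \<inter> fst d)) (transition c d))"


section \<open>Tangent vectors\<close>

text \<open>
  A tangent vector at \<open>p\<close> assigns to every chart around \<open>p\<close> its coordinate vector, subject to the
  transformation law under changes of charts; it is normalised to \<open>0\<close> at all other charts, so that
  the tangent space is a linear subspace of a function space.
\<close>

type_synonym ('a, 'e) tangent_vector = "('a, 'e) chart \<Rightarrow> 'e"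

definition tangent_space ::
    "('a, 'e::euclidean_space) manifold \<Rightarrow> 'a \<Rightarrow> ('a, 'e) tangent_vector set" where
  "tangent_space M p =
     {v. (\<forall>c. c \<notin> charts_at M p \<longrightarrow> v c = 0) \<and>
         (\<forall>c\<in>charts_at M p. \<forall>d\<in>charts_at M p.
            v d = frechet_derivative (transition c d) (at (snd c p)) (v c))}"

text \<open>The tangent vector at \<open>p\<close> with coordinate vector \<open>u\<close> in the chart \<open>c\<close>.\<close>

definition coord_vector ::
    "('a, 'e::euclidean_space) manifold \<Rightarrow> ('a, 'e) chart \<Rightarrow> 'a \<Rightarrow> 'e \<Rightarrow> ('a, 'e) tangent_vector" where
  "coord_vector M c p u =
     (\<lambda>d. if d \<in> charts_at M p
          then frechet_derivative (transition c d) (at (snd c p)) u else 0)"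


section \<open>Smooth functions and tensor fields\<close>

definition smooth_function :: "('a, 'e::euclidean_space) manifold \<Rightarrow> ('a \<Rightarrow> real) \<Rightarrow> bool" where
  "smooth_function M f \<longleftrightarrow> (\<forall>c\<in>atlas M. smooth_on (snd c ` fst c) (f \<circ> chart_inv c))"

definition linear_map_on ::
    "'v::real_vector set \<Rightarrow> 'w::real_vector set \<Rightarrow> ('v \<Rightarrow> 'w) \<Rightarrow> bool" where
  "linear_map_on V W f \<longleftrightarrow>
     (\<forall>x\<in>V. f x \<in> W) \<and>
     (\<forall>x\<in>V. \<forall>y\<in>V. f (x + y) = f x + f y) \<and>
     (\<forall>r. \<forall>x\<in>V. f (r *\<^sub>R x) = r *\<^sub>R f x)"

definition vector_field ::
    "('a, 'e::euclidean_space) manifold \<Rightarrow> ('a \<Rightarrow> ('a, 'e) tangent_vector) \<Rightarrow> bool" where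
  "vector_field M X \<longleftrightarrow>
     (\<forall>p\<in>points M. X p \<in> tangent_space M p) \<and>
     (\<forall>c\<in>atlas M. smooth_on (snd c ` fst c) (\<lambda>x. X (chart_inv c x) c))"

definition one_form ::
    "('a, 'e::euclidean_space) manifold \<Rightarrow> ('a \<Rightarrow> ('a, 'e) tangent_vector \<Rightarrow> real) \<Rightarrow> bool" where
  "one_form M \<omega> \<longleftrightarrow>
     (\<forall>p\<in>points M. linear_map_on (tangent_space M p) UNIV (\<omega> p)) \<and>
     (\<forall>c\<in>atlas M. \<forall>u. smooth_on (snd c ` fst c)
        (\<lambda>x. \<omega> (chart_inv c x) (coord_vector M c (chart_inv c x) u)))"

definition tensor_field_1_1 ::
    "('a, 'e::euclidean_space) manifold \<Rightarrow>
     ('a \<Rightarrow> ('a, 'e) tangent_vector \<Rightarrow> ('a, 'e) tangent_vector) \<Rightarrow> bool" where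
  "tensor_field_1_1 M F \<longleftrightarrow>
     (\<forall>p\<in>points M. linear_map_on (tangent_space M p) (tangent_space M p) (F p)) \<and>
     (\<forall>c\<in>atlas M. \<forall>u. smooth_on (snd c ` fst c)
        (\<lambda>x. F (chart_inv c x) (coord_vector M c (chart_inv c x) u) c))"

definition tensor_field_0_2 ::
    "('a, 'e::euclidean_space) manifold \<Rightarrow>
     ('a \<Rightarrow> ('a, 'e) tangent_vector \<Rightarrow> ('a, 'e) tangent_vector \<Rightarrow> real) \<Rightarrow> bool" where
  "tensor_field_0_2 M g \<longleftrightarrow>
     (\<forall>p\<in>points M. \<forall>X\<in>tangent_space M p.
        linear_map_on (tangent_space M p) UNIV (\<lambda>Y. g p X Y) \<and>
        linear_map_on (tangent_space M p) UNIV (\<lambda>Y. g p Y X)) \<and>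
     (\<forall>c\<in>atlas M. \<forall>u w. smooth_on (snd c ` fst c)
        (\<lambda>x. g (chart_inv c x) (coord_vector M c (chart_inv c x) u)
                                (coord_vector M c (chart_inv c x) w)))"

definition pseudo_Riemannian_metric ::
    "('a, 'e::euclidean_space) manifold \<Rightarrow>
     ('a \<Rightarrow> ('a, 'e) tangent_vector \<Rightarrow> ('a, 'e) tangent_vector \<Rightarrow> real) \<Rightarrow> bool" where
  "pseudo_Riemannian_metric M g \<longleftrightarrow>
     tensor_field_0_2 M g \<and>
     (\<forall>p\<in>points M.
        (\<forall>X\<in>tangent_space M p. \<forall>Y\<in>tangent_space M p. g p X Y = g p Y X) \<and>
        (\<forall>X\<in>tangent_space M p. (\<forall>Y\<in>tangent_space M p. g p X Y = 0) \<longrightarrow> X = 0))"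


section \<open>Almost contact manifolds with Norden metric\<close>

definition almost_contact_structure ::
    "('a, 'e::euclidean_space) manifold \<Rightarrow>
     ('a \<Rightarrow> ('a, 'e) tangent_vector \<Rightarrow> ('a, 'e) tangent_vector) \<Rightarrow>
     ('a \<Rightarrow> ('a, 'e) tangent_vector) \<Rightarrow>
     ('a \<Rightarrow> ('a, 'e) tangent_vector \<Rightarrow> real) \<Rightarrow> bool" where
  "almost_contact_structure M \<phi> \<xi> \<eta> \<longleftrightarrow>
     tensor_field_1_1 M \<phi> \<and> vector_field M \<xi> \<and> one_form M \<eta> \<and>
     (\<forall>p\<in>points M.
        (\<forall>X\<in>tangent_space M p. \<phi> p (\<phi> p X) = - X + \<eta> p X *\<^sub>R \<xi> p) \<and>
        \<eta> p (\<xi> p) = 1)"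

definition Norden_metric ::
    "('a, 'e::euclidean_space) manifold \<Rightarrow>
     ('a \<Rightarrow> ('a, 'e) tangent_vector \<Rightarrow> ('a, 'e) tangent_vector) \<Rightarrow>
     ('a \<Rightarrow> ('a, 'e) tangent_vector \<Rightarrow> real) \<Rightarrow>
     ('a \<Rightarrow> ('a, 'e) tangent_vector \<Rightarrow> ('a, 'e) tangent_vector \<Rightarrow> real) \<Rightarrow> bool" where
  "Norden_metric M \<phi> \<eta> g \<longleftrightarrow>
     pseudo_Riemannian_metric M g \<and>
     (\<forall>p\<in>points M. \<forall>X\<in>tangent_space M p. \<forall>Y\<in>tangent_space M p.
        g p (\<phi> p X) (\<phi> p Y) = - g p X Y + \<eta> p X * \<eta> p Y)"

definition almost_contact_Norden_manifold ::
    "nat \<Rightarrow> ('a, 'e::euclidean_space) manifold \<Rightarrow>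
     ('a \<Rightarrow> ('a, 'e) tangent_vector \<Rightarrow> ('a, 'e) tangent_vector) \<Rightarrow>
     ('a \<Rightarrow> ('a, 'e) tangent_vector) \<Rightarrow>
     ('a \<Rightarrow> ('a, 'e) tangent_vector \<Rightarrow> real) \<Rightarrow>
     ('a \<Rightarrow> ('a, 'e) tangent_vector \<Rightarrow> ('a, 'e) tangent_vector \<Rightarrow> real) \<Rightarrow> bool" where
  "almost_contact_Norden_manifold m M \<phi> \<xi> \<eta> g \<longleftrightarrow>
     smooth_manifold M \<and> DIM('e) = 2 * m + 1 \<and>
     almost_contact_structure M \<phi> \<xi> \<eta> \<and> Norden_metric M \<phi> \<eta> g"


section \<open>Submanifolds\<close>

definition smooth_map ::
    "('a, 'e::euclidean_space) manifold \<Rightarrow> ('b, 'f::euclidean_space) manifold \<Rightarrow> ('a \<Rightarrow> 'b) \<Rightarrow> bool"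
  where
  "smooth_map M N f \<longleftrightarrow>
     continuous_map (mtop M) (mtop N) f \<and>
     (\<forall>c\<in>atlas M. \<forall>d\<in>atlas N.
        smooth_on (snd c ` (fst c \<inter> f -` fst d)) (snd d \<circ> f \<circ> chart_inv c))"

text \<open>By the chain rule the differential does not depend on the chart chosen around \<open>p\<close>.\<close>

definition differential ::
    "('a, 'e::euclidean_space) manifold \<Rightarrow> ('b, 'f::euclidean_space) manifold \<Rightarrow> ('a \<Rightarrow> 'b) \<Rightarrow>
     'a \<Rightarrow> ('a, 'e) tangent_vector \<Rightarrow> ('b, 'f) tangent_vector" where
  "differential M N f p v =
     (let c = (SOME c. c \<in> charts_at M p) in
      (\<lambda>d. if d \<in> charts_at N (f p)
           then frechet_derivative (snd d \<circ> f \<circ> chart_inv c) (at (snd c p)) (v c) else 0))"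

definition immersion ::
    "('a, 'e::euclidean_space) manifold \<Rightarrow> ('b, 'f::euclidean_space) manifold \<Rightarrow> ('a \<Rightarrow> 'b) \<Rightarrow> bool"
  where
  "immersion M N f \<longleftrightarrow>
     smooth_map M N f \<and> (\<forall>p\<in>points M. inj_on (differential M N f p) (tangent_space M p))"

text \<open>
  A submanifold is a subset with a smooth structure of its own for which the inclusion is an
  immersion. Its topology may be finer than the subspace topology, so that embedded submanifolds
  are included as a special case.
\<close>

definition submanifold ::
    "('a, 'f::euclidean_space) manifold \<Rightarrow> ('a, 'e::euclidean_space) manifold \<Rightarrow> bool" where
  "submanifold M N \<longleftrightarrow>
     smooth_manifold M \<and> smooth_manifold N \<and> points M \<subseteq> points N \<and> immersion M N (\<lambda>p. p)"

definition incl ::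
    "('a, 'f::euclidean_space) manifold \<Rightarrow> ('a, 'e::euclidean_space) manifold \<Rightarrow>
     'a \<Rightarrow> ('a, 'f) tangent_vector \<Rightarrow> ('a, 'e) tangent_vector" where
  "incl M N = differential M N (\<lambda>p. p)"

definition restrict_metric ::
    "('a, 'f::euclidean_space) manifold \<Rightarrow> ('a, 'e::euclidean_space) manifold \<Rightarrow>
     ('a \<Rightarrow> ('a, 'e) tangent_vector \<Rightarrow> ('a, 'e) tangent_vector \<Rightarrow> real) \<Rightarrow>
     'a \<Rightarrow> ('a, 'f) tangent_vector \<Rightarrow> ('a, 'f) tangent_vector \<Rightarrow> real" where
  "restrict_metric M N g p X Y = g p (incl M N p X) (incl M N p Y)"

definition normal_space_at ::
    "('a, 'f::euclidean_space) manifold \<Rightarrow> ('a, 'e::euclidean_space) manifold \<Rightarrow>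
     ('a \<Rightarrow> ('a, 'e) tangent_vector \<Rightarrow> ('a, 'e) tangent_vector \<Rightarrow> real) \<Rightarrow>
     'a \<Rightarrow> ('a, 'e) tangent_vector set" where
  "normal_space_at M N g p =
     {W \<in> tangent_space N p. \<forall>X\<in>tangent_space M p. g p W (incl M N p X) = 0}"

definition normal_vector_field ::
    "('a, 'f::euclidean_space) manifold \<Rightarrow> ('a, 'e::euclidean_space) manifold \<Rightarrow>
     ('a \<Rightarrow> ('a, 'e) tangent_vector \<Rightarrow> ('a, 'e) tangent_vector \<Rightarrow> real) \<Rightarrow>
     ('a \<Rightarrow> ('a, 'e) tangent_vector) \<Rightarrow> bool" where
  "normal_vector_field M N g W \<longleftrightarrow>
     (\<forall>p\<in>points M. W p \<in> normal_space_at M N g p) \<and>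
     (\<forall>c\<in>atlas M. \<forall>d\<in>atlas N.
        smooth_on (snd c ` (fst c \<inter> fst d)) (\<lambda>x. W (chart_inv c x) d))"

text \<open>
  For normal vectors \<open>N1\<close>, \<open>N2\<close> forming a basis of the normal space at \<open>p\<close>, the decomposition
  \<open>V = X + a N1 + b N2\<close> of a vector \<open>V\<close> of the ambient tangent space into its tangential part \<open>X\<close>
  and its normal part \<open>a N1 + b N2\<close>.
\<close>

definition decomposition ::
    "('a, 'f::euclidean_space) manifold \<Rightarrow> ('a, 'e::euclidean_space) manifold \<Rightarrow> 'a \<Rightarrow>
     ('a, 'e) tangent_vector \<Rightarrow> ('a, 'e) tangent_vector \<Rightarrow> ('a, 'e) tangent_vector \<Rightarrow>
     ('a, 'f) tangent_vector \<times> real \<times> real" where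
  "decomposition M N p N1 N2 V =
     (THE (X, a, b). X \<in> tangent_space M p \<and> V = incl M N p X + a *\<^sub>R N1 + b *\<^sub>R N2)"

definition tangential_part ::
    "('a, 'f::euclidean_space) manifold \<Rightarrow> ('a, 'e::euclidean_space) manifold \<Rightarrow> 'a \<Rightarrow>
     ('a, 'e) tangent_vector \<Rightarrow> ('a, 'e) tangent_vector \<Rightarrow> ('a, 'e) tangent_vector \<Rightarrow>
     ('a, 'f) tangent_vector" where
  "tangential_part M N p N1 N2 V = fst (decomposition M N p N1 N2 V)"

definition normal_coeff1 ::
    "('a, 'f::euclidean_space) manifold \<Rightarrow> ('a, 'e::euclidean_space) manifold \<Rightarrow> 'a \<Rightarrow>
     ('a, 'e) tangent_vector \<Rightarrow> ('a, 'e) tangent_vector \<Rightarrow> ('a, 'e) tangent_vector \<Rightarrow> real" where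
  "normal_coeff1 M N p N1 N2 V = fst (snd (decomposition M N p N1 N2 V))"

definition normal_coeff2 ::
    "('a, 'f::euclidean_space) manifold \<Rightarrow> ('a, 'e::euclidean_space) manifold \<Rightarrow> 'a \<Rightarrow>
     ('a, 'e) tangent_vector \<Rightarrow> ('a, 'e) tangent_vector \<Rightarrow> ('a, 'e) tangent_vector \<Rightarrow> real" where
  "normal_coeff2 M N p N1 N2 V = snd (snd (decomposition M N p N1 N2 V))"

end

(*
  The ambient endomorphism is self-adjoint for g and kills the structure vector field, so the
  conditions on N1, N2 make xi0, xi1, xi2 orthonormal (of signs +, -, +), eta^i is dual to xi_i, and
  the tangential part of the ambient endomorphism is self-adjoint, vanishes on span(xi0, xi1, xi2) and
  squares to -id on the orthogonal complement. On that span, the correction terms of phi map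
  xi = t0 xi0 - t2 xi2 to 0 and exchange xi1 with t2 xi0 + t0 xi2 up to sign, so t0^2 + t2^2 = 1
  gives phi^2 = -id + eta (x) xi; self-adjointness of phi then yields the Norden identity. By the
  dimension hypothesis (u, a, b) |-> u + a N1 + b N2 is a bijection in coordinates, and the solution
  of a smoothly varying invertible linear system is smooth, hence so are the tangential and normal
  parts.
*)

theory Submission
  imports Defs
begin

section \<open>Calculus of smooth functions\<close>

text \<open>The tangential part of the ambient endomorphism has a three-dimensional kernel, whereas
  an almost contact structure allows only the line of \<xi>. The correction terms repair this by
  supplying a complex structure on the two remaining directions. Self-adjointness, where the
  Riemannian theory has skew-adjointness, comes from the minus sign in the Norden identity.
  Smoothness meets a different obstacle. Tangential and normal parts are given by a definite
  description at each point, without a formula in charts, and ambient vectors along M have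
  coordinates only in ambient charts, each of which may cover just a piece of a chart of M. The
  argument therefore works on chart overlaps and characterises the parts by a linear system.
  Differentiating that system gives the same system with another right-hand side, so regularity of
  the solution follows by induction on the order, without formulas for the inverse matrix.\<close>

lemma Ck_on_cong:
  assumes "open S" "\<And>x. x \<in> S \<Longrightarrow> f x = g x" "Ck_on k S f"
  shows "Ck_on k S g"
  using assms(2,3)
proof (induction k arbitrary: f g)
  case 0
  then show ?case by (simp cong: continuous_on_cong)
next
  case (Suc k)
  have g: "(g has_derivative frechet_derivative f (at x)) (at x)" if x: "x \<in> S" for x
  proof -
    have "(f has_derivative frechet_derivative f (at x)) (at x)"
      using Suc.prems(2) x frechet_derivative_works by auto
    then show ?thesis
      by (rule has_derivative_transform_within_open[OF _ \<open>open S\<close> x]) (simp add: Suc.prems(1))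
  qed
  have "Ck_on k S (\<lambda>x. frechet_derivative g (at x) v)" for v
  proof (rule Suc.IH)
    show "frechet_derivative f (at x) v = frechet_derivative g (at x) v" if "x \<in> S" for x
      using frechet_derivative_at[OF g[OF that]] by simp
    show "Ck_on k S (\<lambda>x. frechet_derivative f (at x) v)"
      using Suc.prems(2) by simp
  qed
  then show ?case
    using g by (auto simp: differentiable_def)
qed

text \<open>\<open>Ck_on\<close> refers to the canonical \<open>frechet_derivative\<close>;
  uniqueness of the derivative lets any explicit formula \<open>f'\<close> take its place. Each
  closure rule below then combines a classical differentiation rule with induction on
  \<open>k\<close>.\<close>

lemma Ck_on_Suc_intro:
  assumes "open S" "\<And>x. x \<in> S \<Longrightarrow> (f has_derivative f' x) (at x)"
    and "\<And>v. Ck_on k S (\<lambda>x. f' x v)"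
  shows "Ck_on (Suc k) S f"
proof -
  have "f' x v = frechet_derivative f (at x) v" if "x \<in> S" for x v
    using frechet_derivative_at[OF assms(2)[OF that]] by simp
  then have "Ck_on k S (\<lambda>x. frechet_derivative f (at x) v)" for v
    by (rule Ck_on_cong[OF assms(1) _ assms(3)])
  then show ?thesis
    using assms(2) by (auto simp: differentiable_def)
qed

lemma Ck_on_SucD:
  assumes "Ck_on (Suc k) S f"
  shows "x \<in> S \<Longrightarrow> (f has_derivative frechet_derivative f (at x)) (at x)"
    and "Ck_on k S (\<lambda>x. frechet_derivative f (at x) v)"
  using assms frechet_derivative_works by auto

text \<open>Continuity of differentiable functions starts the induction. Product and chain rules
  leave some factor undifferentiated, and its order is lowered by this lemma.\<close>

lemma Ck_on_Suc_imp: "Ck_on (Suc k) S f \<Longrightarrow> Ck_on k S f"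
proof (induction k arbitrary: f)
  case 0
  then show ?case
    by (auto intro!: continuous_at_imp_continuous_on differentiable_imp_continuous_within)
next
  case (Suc k)
  show ?case
    unfolding Ck_on.simps(2)
    using Suc.IH[OF Ck_on_SucD(2)[OF Suc.prems]] Suc.prems by simp
qed

text \<open>Continuity and \<open>frechet_derivative\<close> at a point depend only on a
  neighbourhood. This lets smoothness on a chart of the submanifold be checked on its overlaps with
  ambient charts.\<close>

lemma Ck_on_local:
  assumes "\<And>x. x \<in> S \<Longrightarrow> \<exists>T. open T \<and> x \<in> T \<and> Ck_on k T f"
  shows "Ck_on k S f"
  using assms
proof (induction k arbitrary: f)
  case 0
  have "continuous (at x) f" if "x \<in> S" for x
    using 0[OF that] continuous_on_eq_continuous_at by auto
  then show ?case
    by (simp add: continuous_at_imp_continuous_on)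
next
  case (Suc k)
  show ?case
    unfolding Ck_on.simps
  proof (intro conjI ballI allI)
    show "f differentiable at x" if "x \<in> S" for x
      using Suc.prems[OF that] by auto
    show "Ck_on k S (\<lambda>x. frechet_derivative f (at x) v)" for v
    proof (rule Suc.IH)
      show "\<exists>T. open T \<and> x \<in> T \<and> Ck_on k T (\<lambda>x. frechet_derivative f (at x) v)" if "x \<in> S" for x
        using Suc.prems[OF that] by auto
    qed
  qed
qed

lemma Ck_on_const: "open S \<Longrightarrow> Ck_on k S (\<lambda>x. c)"
proof (induction k arbitrary: c)
  case (Suc k)
  show ?case
    by (rule Ck_on_Suc_intro[OF Suc.prems has_derivative_const Suc.IH[OF Suc.prems]])
qed simp

lemma Ck_on_add:
  assumes "open S" "Ck_on k S f" "Ck_on k S g"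
  shows "Ck_on k S (\<lambda>x. f x + g x)"
  using assms(2,3)
proof (induction k arbitrary: f g)
  case (Suc k)
  note f = Ck_on_SucD[OF Suc.prems(1)] and g = Ck_on_SucD[OF Suc.prems(2)]
  show ?case
    by (rule Ck_on_Suc_intro[OF \<open>open S\<close> has_derivative_add[OF f(1) g(1)] Suc.IH[OF f(2) g(2)]])
qed (auto intro: continuous_on_add)

lemma Ck_on_bounded_linear:
  assumes "bounded_linear h" "open S" "Ck_on k S f"
  shows "Ck_on k S (\<lambda>x. h (f x))"
  using assms(3)
proof (induction k arbitrary: f)
  case (Suc k)
  note f = Ck_on_SucD[OF Suc.prems]
  show ?case
    by (rule Ck_on_Suc_intro[OF \<open>open S\<close> bounded_linear.has_derivative[OF assms(1) f(1)]
          Suc.IH[OF f(2)]])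
qed (use assms in \<open>auto intro: bounded_linear.continuous_on\<close>)

lemma (in bounded_bilinear) Ck_on:
  assumes "open S" "Ck_on k S f" "Ck_on k S g"
  shows "Ck_on k S (\<lambda>x. prod (f x) (g x))"
  using assms(2,3)
proof (induction k arbitrary: f g)
  case 0
  then show ?case by (auto intro: continuous_on)
next
  case (Suc k)
  note f = Ck_on_SucD[OF Suc.prems(1)] and g = Ck_on_SucD[OF Suc.prems(2)]
  show ?case
  proof (rule Ck_on_Suc_intro[OF \<open>open S\<close>])
    show "((\<lambda>x. prod (f x) (g x)) has_derivative
       (\<lambda>v. prod (f x) (frechet_derivative g (at x) v) + prod (frechet_derivative f (at x) v) (g x))) (at x)"
      if "x \<in> S" for x
      by (rule FDERIV[OF f(1)[OF that] g(1)[OF that]])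
    show "Ck_on k S (\<lambda>x. prod (f x) (frechet_derivative g (at x) v) + prod (frechet_derivative f (at x) v) (g x))" for v
      by (rule Ck_on_add[OF \<open>open S\<close> Suc.IH[OF Ck_on_Suc_imp[OF Suc.prems(1)] g(2)]
            Suc.IH[OF f(2) Ck_on_Suc_imp[OF Suc.prems(2)]]])
  qed
qed

lemma Ck_on_sum:
  assumes "open S" "\<And>i. i \<in> I \<Longrightarrow> Ck_on k S (f i)"
  shows "Ck_on k S (\<lambda>x. \<Sum>i\<in>I. f i x)"
  using assms(2)
  by (induction I rule: infinite_finite_induct) (simp_all add: Ck_on_const Ck_on_add assms(1))

lemma linear_eq_sum_Basis:
  fixes A :: "'e::euclidean_space \<Rightarrow> 'f::real_vector"
  assumes "linear A"
  shows "A w = (\<Sum>b\<in>Basis. (w \<bullet> b) *\<^sub>R A b)"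
proof -
  have "A w = A (\<Sum>b\<in>Basis. (w \<bullet> b) *\<^sub>R b)" by (simp add: euclidean_representation)
  also have "\<dots> = (\<Sum>b\<in>Basis. (w \<bullet> b) *\<^sub>R A b)"
    using assms by (simp add: linear_sum linear_cmul)
  finally show ?thesis .
qed

text \<open>Expanding \<open>w x\<close> in \<open>Basis\<close> turns \<open>A x (w x)\<close> into
  a finite sum of products, so regularity for each fixed \<open>v\<close> suffices and
  operator-valued maps are avoided.\<close>

lemma Ck_on_linear_family:
  fixes A :: "'a::euclidean_space \<Rightarrow> 'e::euclidean_space \<Rightarrow> 'f::real_normed_vector"
  assumes "open S" "\<And>x. x \<in> S \<Longrightarrow> linear (A x)" "\<And>v. Ck_on k S (\<lambda>x. A x v)" "Ck_on k S w"
  shows "Ck_on k S (\<lambda>x. A x (w x))"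
proof (rule Ck_on_cong[OF \<open>open S\<close>])
  show "(\<Sum>b\<in>Basis. (w x \<bullet> b) *\<^sub>R A x b) = A x (w x)" if "x \<in> S" for x
    using linear_eq_sum_Basis assms(2)[OF that] by metis
  show "Ck_on k S (\<lambda>x. \<Sum>b\<in>Basis. (w x \<bullet> b) *\<^sub>R A x b)"
    by (rule Ck_on_sum[OF \<open>open S\<close> bounded_bilinear.Ck_on[OF bounded_bilinear_scaleR \<open>open S\<close>
          Ck_on_bounded_linear[OF bounded_linear_inner_left \<open>open S\<close> assms(4)] assms(3)]])
qed

text \<open>By the chain rule the derivative is a linear family, formed from derivatives of
  \<open>g\<close> along \<open>f\<close>, applied to a derivative of \<open>f\<close>. The
  induction hypothesis is used with \<open>g\<close> replaced by its directional derivatives while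
  \<open>f\<close> stays fixed.\<close>

lemma Ck_on_compose:
  fixes f :: "'a::euclidean_space \<Rightarrow> 'e::euclidean_space" and g :: "'e \<Rightarrow> 'f::real_normed_vector"
  assumes "open S" "f ` S \<subseteq> T" "Ck_on k S f" "Ck_on k T g"
  shows "Ck_on k S (\<lambda>x. g (f x))"
  using assms(3,4)
proof (induction k arbitrary: g)
  case 0
  then show ?case using assms(2) by (auto intro: continuous_on_compose2)
next
  case (Suc k)
  note f = Ck_on_SucD[OF Suc.prems(1)] and g = Ck_on_SucD[OF Suc.prems(2)]
  have fT: "f x \<in> T" if "x \<in> S" for x using assms(2) that by auto
  show ?case
  proof (rule Ck_on_Suc_intro[OF \<open>open S\<close>])
    show "((\<lambda>x. g (f x)) has_derivative
      (\<lambda>v. frechet_derivative g (at (f x)) (frechet_derivative f (at x) v))) (at x)" if "x \<in> S" for x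
      using has_derivative_compose[OF f(1)[OF that] g(1)[OF fT[OF that]]] by simp
    show "Ck_on k S (\<lambda>x. frechet_derivative g (at (f x)) (frechet_derivative f (at x) v))" for v
    proof (rule Ck_on_linear_family[OF \<open>open S\<close> _ _ f(2)])
      show "linear (frechet_derivative g (at (f x)))" if "x \<in> S" for x
        using g(1)[OF fT[OF that]] has_derivative_linear by blast
      show "Ck_on k S (\<lambda>x. frechet_derivative g (at (f x)) w)" for w
        by (rule Suc.IH[OF Ck_on_Suc_imp[OF Suc.prems(1)] g(2)])
    qed
  qed
qed


section \<open>Smooth dependence of the solution of a linear system\<close>

text \<open>The sum over the basis dominates the operator norm of the difference; it converts
  convergence at each fixed vector into uniform convergence.\<close>

lemma norm_linear_diff_le:
  fixes A B :: "'e::euclidean_space \<Rightarrow> 'f::real_normed_vector"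
  assumes "linear A" "linear B"
  shows "norm (A v - B v) \<le> (\<Sum>b\<in>Basis. norm (A b - B b)) * norm v"
proof -
  have "A v - B v = (\<Sum>b\<in>Basis. (v \<bullet> b) *\<^sub>R (A b - B b))"
    using linear_eq_sum_Basis[OF linear_compose_sub[OF assms], of v] .
  then have "norm (A v - B v) \<le> (\<Sum>b\<in>Basis. norm ((v \<bullet> b) *\<^sub>R (A b - B b)))"
    by (metis norm_sum)
  also have "\<dots> \<le> (\<Sum>b\<in>Basis. norm v * norm (A b - B b))"
    by (intro sum_mono) (simp add: mult_right_mono Basis_le_norm)
  finally show ?thesis by (simp add: sum_distrib_left mult.commute)
qed

lemma tendsto_sum_norm_diff_zero:
  fixes A :: "'d::euclidean_space \<Rightarrow> 'e::euclidean_space \<Rightarrow> 'f::real_normed_vector"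
  assumes "\<And>v. isCont (\<lambda>x. A x v) x0"
  shows "((\<lambda>x. \<Sum>b\<in>Basis. norm (A x b - A x0 b)) \<longlongrightarrow> 0) (at x0)"
proof -
  have "((\<lambda>x. norm (A x b - A x0 b)) \<longlongrightarrow> 0) (at x0)" for b
    using assms[of b] unfolding isCont_def by (simp add: tendsto_norm_zero LIM_zero)
  then show ?thesis
    by (rule tendsto_null_sum)
qed

text \<open>Injectivity gives a lower bound \<open>B\<close> for \<open>A x0\<close>. A perturbation
  of size below \<open>B / 2\<close> leaves the bound \<open>B / 2\<close> by the triangle
  inequality.\<close>

lemma eventually_uniform_lower_bound:
  fixes A :: "'d::euclidean_space \<Rightarrow> 'e::euclidean_space \<Rightarrow> 'f::euclidean_space"
  assumes "open S" "x0 \<in> S" "\<And>x. x \<in> S \<Longrightarrow> linear (A x)" "inj (A x0)"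
    and "\<And>v. isCont (\<lambda>x. A x v) x0"
  obtains m where "m > 0" "\<forall>\<^sub>F x in at x0. \<forall>v. m * norm v \<le> norm (A x v)"
proof -
  obtain B where B: "B > 0" "\<And>v. B * norm v \<le> norm (A x0 v)"
    using linear_inj_bounded_below_pos[OF assms(3)[OF assms(2)] assms(4)] by blast
  have "\<forall>\<^sub>F x in at x0. (\<Sum>b\<in>Basis. norm (A x b - A x0 b)) < B / 2"
    using order_tendstoD(2)[OF tendsto_sum_norm_diff_zero[where A = A and ?x0.0 = x0, OF assms(5)], of "B / 2"] B(1)
    by simp
  moreover have "\<forall>\<^sub>F x in at x0. x \<in> S"
    using assms(1,2) eventually_at_topological by blast
  ultimately have "\<forall>\<^sub>F x in at x0. \<forall>v. (B / 2) * norm v \<le> norm (A x v)"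
  proof eventually_elim
    case (elim x)
    show ?case
    proof
      fix v
      have "norm (A x v - A x0 v) \<le> (B / 2) * norm v"
        using norm_linear_diff_le[OF assms(3)[OF elim(2)] assms(3)[OF assms(2)], of v]
          mult_right_mono[OF less_imp_le[OF elim(1)], of "norm v"] by simp
      then show "(B / 2) * norm v \<le> norm (A x v)"
        using B(2)[of v] norm_triangle_ineq2[of "A x0 v" "A x v"]
        by (simp add: norm_minus_commute)
    qed
  qed
  with B(1) that[of "B / 2"] show thesis by simp
qed

text \<open>Applying \<open>A x\<close> to \<open>u x - u x0\<close> gives
  \<open>w x - A x (u x0)\<close>, where the unknown is frozen at \<open>x0\<close>. This tends to
  0, and the uniform lower bound carries the limit over to \<open>u x - u x0\<close>.\<close>

lemma isCont_linear_solution: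
  fixes A :: "'d::euclidean_space \<Rightarrow> 'e::euclidean_space \<Rightarrow> 'f::euclidean_space"
  assumes "open S" "x0 \<in> S" "\<And>x. x \<in> S \<Longrightarrow> linear (A x)" "inj (A x0)"
    and A: "\<And>v. isCont (\<lambda>x. A x v) x0" and w: "isCont w x0"
    and sol: "\<And>x. x \<in> S \<Longrightarrow> A x (u x) = w x"
  shows "isCont u x0"
proof -
  obtain m where m: "m > 0" "\<forall>\<^sub>F x in at x0. \<forall>v. m * norm v \<le> norm (A x v)"
    using eventually_uniform_lower_bound[OF assms(1-4) A] by blast
  have S: "\<forall>\<^sub>F x in at x0. x \<in> S"
    using assms(1,2) eventually_at_topological by blast
  have "((\<lambda>x. norm (w x - A x (u x0)) / m) \<longlongrightarrow> norm (w x0 - A x0 (u x0)) / m) (at x0)"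
    using A[of "u x0"] w m(1) unfolding isCont_def by (intro tendsto_intros) auto
  then have lim: "((\<lambda>x. norm (w x - A x (u x0)) / m) \<longlongrightarrow> 0) (at x0)"
    using sol[OF assms(2)] by simp
  have "\<forall>\<^sub>F x in at x0. norm (u x - u x0) \<le> norm (w x - A x (u x0)) / m"
    using m(2) S
  proof eventually_elim
    case (elim x)
    have "m * norm (u x - u x0) \<le> norm (A x (u x - u x0))" using elim(1) by blast
    then show ?case
      using m(1) sol[OF elim(2)] assms(3)[OF elim(2)]
      by (simp add: linear_diff pos_le_divide_eq mult.commute)
  qed
  then have "((\<lambda>x. u x - u x0) \<longlongrightarrow> 0) (at x0)"
    using lim by (rule Lim_null_comparison)
  then show ?thesis unfolding isCont_def by (simp add: LIM_zero_iff)
qed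

text \<open>Formal differentiation of \<open>A x (u x) = w x\<close> predicts this derivative; the
  proof establishes it without presupposing that \<open>u\<close> is differentiable.\<close>

lemma has_derivative_linear_solution:
  fixes A :: "'d::euclidean_space \<Rightarrow> 'e::euclidean_space \<Rightarrow> 'f::euclidean_space"
  assumes "open S" "x0 \<in> S" "\<And>x. x \<in> S \<Longrightarrow> linear (A x)" "bij (A x0)"
    and A: "\<And>v. ((\<lambda>x. A x v) has_derivative A' v) (at x0)"
    and w: "(w has_derivative w') (at x0)"
    and sol: "\<And>x. x \<in> S \<Longrightarrow> A x (u x) = w x"
  shows "(u has_derivative (\<lambda>h. inv (A x0) (w' h - A' (u x0) h))) (at x0)"
proof -
  \<comment> \<open>With the unknown frozen, \<open>r x = A x (u x - u x0)\<close> on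
    \<open>S\<close>, so \<open>r x0 = 0\<close>; the candidate derivative \<open>z\<close> solves
    \<open>A x0 (z h) = r' h\<close>.\<close>
  define r where "r = (\<lambda>x. w x - A x (u x0))"
  define r' where "r' = (\<lambda>h. w' h - A' (u x0) h)"
  define z where "z = (\<lambda>h. inv (A x0) (r' h))"
  define R where "R = (\<lambda>x. norm (r x - r x0 - r' (x - x0)) / norm (x - x0))"
  define D where "D = (\<lambda>x. \<Sum>b\<in>Basis. norm (A x b - A x0 b))"
  have Az: "A x0 (z h) = r' h" for h
    unfolding z_def using assms(4) by (simp add: bij_is_surj surj_f_inv_f)
  have "linear (inv (A x0))"
  proof (rule linearI)
    note lin = assms(3)[OF assms(2)]
    fix v v' c
    have *: "inv (A x0) y = e" if "A x0 e = y" for e y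
      using that bij_is_inj[OF assms(4)] by auto
    have **: "A x0 (inv (A x0) y) = y" for y
      using assms(4) by (simp add: bij_is_surj surj_f_inv_f)
    show "inv (A x0) (v + v') = inv (A x0) v + inv (A x0) v'"
      "inv (A x0) (c *\<^sub>R v) = c *\<^sub>R inv (A x0) v"
      using lin by (auto intro!: * simp: linear_add linear_cmul **)
  qed
  have r: "(r has_derivative r') (at x0)"
    unfolding r_def r'_def by (intro has_derivative_diff A w)
  have bz: "bounded_linear z"
    unfolding z_def
    using \<open>linear (inv (A x0))\<close> r bounded_linear_compose has_derivative_bounded_linear linear_conv_bounded_linear
    by blast
  obtain K where K: "\<And>h. norm (z h) \<le> norm h * K"
    using bounded_linear.bounded[OF bz] by blast
  have Ac: "isCont (\<lambda>x. A x v) x0" for v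
    using A has_derivative_continuous by blast
  obtain m where m: "m > 0" "\<forall>\<^sub>F x in at x0. \<forall>v. m * norm v \<le> norm (A x v)"
    using eventually_uniform_lower_bound[OF assms(1-3) bij_is_inj[OF assms(4)] Ac] by blast
  have S: "\<forall>\<^sub>F x in at x0. x \<in> S"
    using assms(1,2) eventually_at_topological by blast
  have "((\<lambda>x. (R x + D x * K) / m) \<longlongrightarrow> (0 + 0 * K) / m) (at x0)"
    unfolding D_def R_def using r[unfolded has_derivative_iff_norm] m(1)
    by (intro tendsto_intros tendsto_sum_norm_diff_zero Ac) auto
  then have lim: "((\<lambda>x. (R x + D x * K) / m) \<longlongrightarrow> 0) (at x0)" by simp
  have ne: "\<forall>\<^sub>F x in at x0. x \<noteq> x0"
    by (simp add: eventually_at_filter)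
  have "\<forall>\<^sub>F x in at x0. norm (norm (u x - u x0 - z (x - x0)) / norm (x - x0)) \<le> (R x + D x * K) / m"
    using m(2) S ne
  proof eventually_elim
    case (elim x)
    let ?h = "x - x0"
    \<comment> \<open>The approximation error, seen through \<open>A x\<close>, splits into the
      remainder of \<open>r\<close>, equal to \<open>R x * norm ?h\<close>, and the cost of
      replacing \<open>A x0\<close> by \<open>A x\<close>, at most
      \<open>D x * (norm ?h * K)\<close>.\<close>
    have "A x (u x - u x0 - z ?h) = (r x - r x0 - r' ?h) - (A x (z ?h) - A x0 (z ?h))"
      using assms(3)[OF elim(2)] sol[OF elim(2)] sol[OF assms(2)] by (simp add: linear_diff r_def Az)
    then have "m * norm (u x - u x0 - z ?h)
        \<le> norm (r x - r x0 - r' ?h) + norm (A x (z ?h) - A x0 (z ?h))"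
      using elim(1)[rule_format, of "u x - u x0 - z ?h"] by (metis norm_triangle_ineq4 order_trans)
    also have "norm (A x (z ?h) - A x0 (z ?h)) \<le> D x * norm (z ?h)"
      unfolding D_def by (intro norm_linear_diff_le assms(3) elim(2) assms(2))
    also have "\<dots> \<le> D x * (norm ?h * K)"
      using K by (intro mult_left_mono) (auto simp: D_def sum_nonneg)
    also have "norm (r x - r x0 - r' ?h) = R x * norm ?h"
      using elim(3) by (simp add: R_def)
    finally have "m * norm (u x - u x0 - z ?h) \<le> (R x + D x * K) * norm ?h"
      by (simp add: algebra_simps)
    then show ?case
      using m(1) elim(3) by (simp add: field_simps)
  qed
  then have "((\<lambda>x. norm (u x - u x0 - z (x - x0)) / norm (x - x0)) \<longlongrightarrow> 0) (at x0)"
    using lim by (rule Lim_null_comparison)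
  then show ?thesis
    using bz unfolding has_derivative_iff_norm z_def r'_def by blast
qed

text \<open>The derivative of \<open>u\<close> in a fixed direction solves the same system with a
  right-hand side containing \<open>u\<close> undifferentiated. The induction hypothesis is thus
  used twice, for \<open>u\<close> at order \<open>k\<close> and then for its derivative, which is
  why \<open>u\<close> and \<open>w\<close> are arbitrary in the induction.\<close>

lemma Ck_on_linear_solution:
  fixes A :: "'d::euclidean_space \<Rightarrow> 'e::euclidean_space \<Rightarrow> 'f::euclidean_space"
  assumes "open S" "\<And>x. x \<in> S \<Longrightarrow> linear (A x)" "\<And>x. x \<in> S \<Longrightarrow> bij (A x)"
    and "\<And>v. Ck_on k S (\<lambda>x. A x v)" "Ck_on k S w" "\<And>x. x \<in> S \<Longrightarrow> A x (u x) = w x"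
  shows "Ck_on k S u"
  using assms(4-6)
proof (induction k arbitrary: u w)
  case 0
  show ?case
    unfolding Ck_on.simps
  proof (rule continuous_at_imp_continuous_on, rule ballI)
    fix x assume x: "x \<in> S"
    have "isCont (\<lambda>x. A x v) x" "isCont w x" for v
      using 0(1)[of v] 0(2) x \<open>open S\<close> by (simp_all add: continuous_on_eq_continuous_at)
    then show "isCont u x"
      using isCont_linear_solution[where A = A and w = w, OF \<open>open S\<close> x assms(2) bij_is_inj[OF assms(3)[OF x]]]
        0(3) by blast
  qed
next
  case (Suc k)
  let ?A' = "\<lambda>x v. frechet_derivative (\<lambda>x. A x v) (at x)"
  let ?r = "\<lambda>x h. frechet_derivative w (at x) h - ?A' x (u x) h"
  note A = Ck_on_SucD[OF Suc.prems(1)] and w = Ck_on_SucD[OF Suc.prems(2)]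
  have uk: "Ck_on k S u"
    by (rule Suc.IH[OF Ck_on_Suc_imp[OF Suc.prems(1)] Ck_on_Suc_imp[OF Suc.prems(2)] Suc.prems(3)])
  show ?case
  proof (rule Ck_on_Suc_intro[OF \<open>open S\<close>])
    show "(u has_derivative (\<lambda>h. inv (A x) (?r x h))) (at x)" if "x \<in> S" for x
      by (rule has_derivative_linear_solution[OF assms(1) that assms(2) assms(3)[OF that] A(1)[OF that]
          w(1)[OF that] Suc.prems(3)])
    show "Ck_on k S (\<lambda>x. inv (A x) (?r x h))" for h
    proof (rule Suc.IH[OF Ck_on_Suc_imp[OF Suc.prems(1)]])
      show "A x (inv (A x) (?r x h)) = ?r x h" if "x \<in> S" for x
        using assms(3)[OF that] by (simp add: bij_is_surj surj_f_inv_f)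
      \<comment> \<open>Linearity in \<open>v\<close> survives differentiation in \<open>x\<close>
        because it holds throughout the open set \<open>S\<close>;
        \<open>Ck_on_linear_family\<close> can then insert the varying argument
        \<open>u x\<close>.\<close>
      have lin: "linear (\<lambda>v. ?A' x v h)" if x: "x \<in> S" for x
      proof (rule linearI)
        note lin = assms(2)[OF x]
        have eq: "?A' x v = D" if "((\<lambda>x. A x v) has_derivative D) (at x)" for v D
          using frechet_derivative_at[OF that] by simp
        show "?A' x (v + v') h = ?A' x v h + ?A' x v' h" for v v'
        proof -
          have "((\<lambda>x. A x (v + v')) has_derivative (\<lambda>h. ?A' x v h + ?A' x v' h)) (at x)"
            by (rule has_derivative_transform_within_open[OF has_derivative_add[OF A(1)[OF x] A(1)[OF x]] \<open>open S\<close> x])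
               (simp add: assms(2) linear_add)
          then show ?thesis by (simp add: eq)
        qed
        show "?A' x (c *\<^sub>R v) h = c *\<^sub>R ?A' x v h" for c v
        proof -
          have "((\<lambda>x. A x (c *\<^sub>R v)) has_derivative (\<lambda>h. c *\<^sub>R ?A' x v h)) (at x)"
            by (rule has_derivative_transform_within_open[OF has_derivative_scaleR_right[OF A(1)[OF x]] \<open>open S\<close> x])
               (simp add: assms(2) linear_cmul)
          then show ?thesis by (simp add: eq)
        qed
      qed
      have "Ck_on k S (\<lambda>x. ?A' x (u x) h)"
        by (rule Ck_on_linear_family[OF \<open>open S\<close> lin A(2) uk])
      from Ck_on_add[OF \<open>open S\<close> w(2)
          Ck_on_bounded_linear[OF bounded_linear_minus[OF bounded_linear_ident] \<open>open S\<close> this]]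
      show "Ck_on k S (\<lambda>x. ?r x h)" by simp
    qed
  qed
qed


section \<open>Closure properties of smooth functions, order by order\<close>

lemma smooth_on_cong:
  "open S \<Longrightarrow> (\<And>x. x \<in> S \<Longrightarrow> f x = g x) \<Longrightarrow> smooth_on S f \<Longrightarrow> smooth_on S g"
  unfolding smooth_on_def using Ck_on_cong by blast

lemma smooth_on_local:
  "(\<And>x. x \<in> S \<Longrightarrow> \<exists>T. open T \<and> x \<in> T \<and> smooth_on T f) \<Longrightarrow> smooth_on S f"
  unfolding smooth_on_def using Ck_on_local by (metis (full_types))

lemma smooth_on_const: "open S \<Longrightarrow> smooth_on S (\<lambda>x. c)"
  by (simp add: smooth_on_def Ck_on_const)

lemma smooth_on_add:
  "open S \<Longrightarrow> smooth_on S f \<Longrightarrow> smooth_on S g \<Longrightarrow> smooth_on S (\<lambda>x. f x + g x)"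
  by (simp add: smooth_on_def Ck_on_add)

lemma smooth_on_bounded_linear:
  "bounded_linear h \<Longrightarrow> open S \<Longrightarrow> smooth_on S f \<Longrightarrow> smooth_on S (\<lambda>x. h (f x))"
  by (simp add: smooth_on_def Ck_on_bounded_linear)

lemma smooth_on_scaleR:
  "open S \<Longrightarrow> smooth_on S f \<Longrightarrow> smooth_on S g \<Longrightarrow> smooth_on S (\<lambda>x. f x *\<^sub>R g x)"
  by (simp add: smooth_on_def bounded_bilinear.Ck_on[OF bounded_bilinear_scaleR])

lemma smooth_on_mult:
  fixes f g :: "'a::euclidean_space \<Rightarrow> real"
  shows "open S \<Longrightarrow> smooth_on S f \<Longrightarrow> smooth_on S g \<Longrightarrow> smooth_on S (\<lambda>x. f x * g x)"
  using smooth_on_scaleR[of S f g] by simp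

lemma smooth_on_minus: "open S \<Longrightarrow> smooth_on S f \<Longrightarrow> smooth_on S (\<lambda>x. - f x)"
  by (rule smooth_on_bounded_linear[OF bounded_linear_minus[OF bounded_linear_ident]])

lemma smooth_on_diff:
  "open S \<Longrightarrow> smooth_on S f \<Longrightarrow> smooth_on S g \<Longrightarrow> smooth_on S (\<lambda>x. f x - g x)"
  using smooth_on_add[OF _ _ smooth_on_minus, of S f g] by simp

lemma smooth_on_linear_family:
  fixes A :: "'a::euclidean_space \<Rightarrow> 'e::euclidean_space \<Rightarrow> 'f::real_normed_vector"
  assumes "open S" "\<And>x. x \<in> S \<Longrightarrow> linear (A x)" "\<And>v. smooth_on S (\<lambda>x. A x v)" "smooth_on S w"
  shows "smooth_on S (\<lambda>x. A x (w x))"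
  using assms Ck_on_linear_family[where A = A, OF assms(1,2)] unfolding smooth_on_def by blast

lemma smooth_on_compose:
  fixes f :: "'a::euclidean_space \<Rightarrow> 'e::euclidean_space" and g :: "'e \<Rightarrow> 'f::real_normed_vector"
  assumes "open S" "f ` S \<subseteq> T" "smooth_on S f" "smooth_on T g"
  shows "smooth_on S (\<lambda>x. g (f x))"
  using assms Ck_on_compose[OF assms(1,2)] unfolding smooth_on_def by blast

lemma smooth_on_linear_solution:
  fixes A :: "'d::euclidean_space \<Rightarrow> 'e::euclidean_space \<Rightarrow> 'f::euclidean_space"
  assumes "open S" "\<And>x. x \<in> S \<Longrightarrow> linear (A x)" "\<And>x. x \<in> S \<Longrightarrow> bij (A x)"
    and "\<And>v. smooth_on S (\<lambda>x. A x v)" "smooth_on S w" "\<And>x. x \<in> S \<Longrightarrow> A x (u x) = w x"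
  shows "smooth_on S u"
  using assms Ck_on_linear_solution[of S A _ w u] unfolding smooth_on_def by blast

lemma smooth_on_has_derivative:
  assumes "smooth_on S f" "x \<in> S"
  shows "(f has_derivative frechet_derivative f (at x)) (at x)"
  using assms Ck_on_SucD(1) unfolding smooth_on_def by blast

lemma smooth_on_frechet_derivative:
  "smooth_on S f \<Longrightarrow> smooth_on S (\<lambda>x. frechet_derivative f (at x) v)"
  using Ck_on_SucD(2) unfolding smooth_on_def by blast


section \<open>Linear algebra at a point\<close>

lemma linear_map_onD:
  assumes "linear_map_on V W f"
  shows "x \<in> V \<Longrightarrow> f x \<in> W"
    and "x \<in> V \<Longrightarrow> y \<in> V \<Longrightarrow> f (x + y) = f x + f y"
    and "x \<in> V \<Longrightarrow> f (r *\<^sub>R x) = r *\<^sub>R f x"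
  using assms by (simp_all add: linear_map_on_def)

lemma linear_map_on_minus:
  "subspace V \<Longrightarrow> linear_map_on V W f \<Longrightarrow> x \<in> V \<Longrightarrow> f (- x) = - f x"
  using linear_map_onD(3)[of V W f x "-1"] by simp

lemma linear_map_on_diff:
  "subspace V \<Longrightarrow> linear_map_on V W f \<Longrightarrow> x \<in> V \<Longrightarrow> y \<in> V \<Longrightarrow> f (x - y) = f x - f y"
  using linear_map_onD(2)[of V W f x "- y"] linear_map_on_minus[of V W f y] subspace_neg[of V y] by simp

lemma linear_map_on_zero: "subspace V \<Longrightarrow> linear_map_on V W f \<Longrightarrow> f 0 = 0"
  using linear_map_onD(3)[of V W f 0 0] subspace_0[of V] by simp

text \<open>The carrier is a subspace rather than a type because the tangent spaces at all points of
  a manifold are subsets of one function type.\<close>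

locale symmetric_form =
  fixes V :: "'v::real_vector set" and g :: "'v \<Rightarrow> 'v \<Rightarrow> real"
  assumes subspace_V: "subspace V"
    and form_linear: "x \<in> V \<Longrightarrow> linear_map_on V UNIV (g x)"
    and form_sym: "x \<in> V \<Longrightarrow> y \<in> V \<Longrightarrow> g x y = g y x"
begin

lemmas V_closed [simp] = subspace_add[OF subspace_V] subspace_scale[OF subspace_V]
  subspace_neg[OF subspace_V] subspace_diff[OF subspace_V] subspace_0[OF subspace_V]

lemma form_right [simp]:
  assumes "x \<in> V" "y \<in> V"
  shows "z \<in> V \<Longrightarrow> g x (y + z) = g x y + g x z" "z \<in> V \<Longrightarrow> g x (y - z) = g x y - g x z"
    "g x (- y) = - g x y" "g x (r *\<^sub>R y) = r * g x y"
  using linear_map_onD[OF form_linear[OF assms(1)]] assms linear_map_on_minus[OF subspace_V form_linear]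
    linear_map_on_diff[OF subspace_V form_linear] by simp_all

lemma form_left [simp]:
  assumes "x \<in> V" "y \<in> V"
  shows "z \<in> V \<Longrightarrow> g (y + z) x = g y x + g z x" "z \<in> V \<Longrightarrow> g (y - z) x = g y x - g z x"
    "g (- y) x = - g y x" "g (r *\<^sub>R y) x = r * g y x"
  using assms by (simp_all add: form_sym[of _ x])

end

section \<open>Almost contact Norden structures on a vector space\<close>

locale norden_space = symmetric_form V g
  for V :: "'v::real_vector set" and g +
  fixes \<phi> :: "'v \<Rightarrow> 'v" and \<xi> :: 'v and \<eta> :: "'v \<Rightarrow> real"
  assumes phi_linear: "linear_map_on V V \<phi>" and xi_in [simp]: "\<xi> \<in> V"
    and eta_linear: "linear_map_on V UNIV \<eta>"
    and phi_phi: "x \<in> V \<Longrightarrow> \<phi> (\<phi> x) = - x + \<eta> x *\<^sub>R \<xi>"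
    and eta_xi: "\<eta> \<xi> = 1"
    and norden: "x \<in> V \<Longrightarrow> y \<in> V \<Longrightarrow> g (\<phi> x) (\<phi> y) = - g x y + \<eta> x * \<eta> y"
begin

lemma phi_simps [simp]:
  assumes "x \<in> V"
  shows "\<phi> x \<in> V" "y \<in> V \<Longrightarrow> \<phi> (x + y) = \<phi> x + \<phi> y" "y \<in> V \<Longrightarrow> \<phi> (x - y) = \<phi> x - \<phi> y"
    "\<phi> (- x) = - \<phi> x" "\<phi> (r *\<^sub>R x) = r *\<^sub>R \<phi> x"
  using linear_map_onD[OF phi_linear] assms linear_map_on_minus[OF subspace_V phi_linear]
    linear_map_on_diff[OF subspace_V phi_linear] by simp_all

lemma xi_nonzero: "\<xi> \<noteq> 0"
  using eta_xi linear_map_on_zero[OF subspace_V eta_linear] by auto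

text \<open>The axiom gives \<open>\<phi> (\<phi> \<xi>) = 0\<close>. Applied to
  \<open>\<phi> \<xi>\<close> it then makes \<open>\<phi> \<xi>\<close> a multiple \<open>?a\<close>
  of \<open>\<xi>\<close>, and a further application of \<open>\<phi>\<close> shows that the square
  of \<open>?a\<close> is 0.\<close>

lemma phi_xi: "\<phi> \<xi> = 0"
proof -
  let ?a = "\<eta> (\<phi> \<xi>)"
  have pp: "\<phi> (\<phi> \<xi>) = 0" by (simp add: phi_phi eta_xi)
  then have "\<phi> (\<phi> (\<phi> \<xi>)) = 0" using linear_map_on_zero[OF subspace_V phi_linear] by simp
  then have eq: "\<phi> \<xi> = ?a *\<^sub>R \<xi>" by (simp add: phi_phi[of "\<phi> \<xi>"])
  have "\<phi> (\<phi> \<xi>) = ?a *\<^sub>R \<phi> \<xi>" by (subst eq) simp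
  then have "?a *\<^sub>R (?a *\<^sub>R \<xi>) = 0" using pp eq by metis
  then have "?a = 0" using xi_nonzero by simp
  with eq show ?thesis by simp
qed

text \<open>This is the Norden identity at \<open>y = \<xi>\<close>, whose left side vanishes with
  \<open>\<phi> \<xi>\<close>.\<close>

lemma form_xi: "x \<in> V \<Longrightarrow> g x \<xi> = \<eta> x"
  using norden[of x \<xi>] form_right(4)[of "\<phi> x" \<xi> 0] by (simp add: phi_xi eta_xi)

text \<open>The threefold application of \<open>\<phi>\<close> is evaluated in two ways, by the
  axiom at \<open>x\<close> and by the axiom at \<open>\<phi> x\<close>; the difference is a
  multiple of \<open>\<xi>\<close>.\<close>

lemma eta_phi: "x \<in> V \<Longrightarrow> \<eta> (\<phi> x) = 0"
proof -
  assume x: "x \<in> V"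
  have "\<phi> (\<phi> (\<phi> x)) = - \<phi> x" using x by (simp add: phi_phi[OF x] phi_xi)
  then have "\<eta> (\<phi> x) *\<^sub>R \<xi> = 0" using phi_phi[of "\<phi> x"] x by simp
  then show ?thesis using xi_nonzero by simp
qed

text \<open>In the Norden identity for \<open>x\<close> and \<open>\<phi> y\<close> both
  \<eta>-terms drop out by \<open>eta_phi\<close>, and the two minus signs cancel.\<close>

lemma phi_selfadjoint:
  assumes "x \<in> V" "y \<in> V" shows "g (\<phi> x) y = g x (\<phi> y)"
  using norden[of x "\<phi> y"] assms by (simp add: phi_phi eta_phi form_xi)

end

text \<open>The part of the induced structure on the tangent space that does not involve \<open>t0\<close> and \<open>t2\<close>;
  \<open>F\<close> restricts to a complex structure on the orthogonal complement of \<open>z0\<close>, \<open>z1\<close>, \<open>z2\<close>.\<close>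

locale induced_structure = symmetric_form T h
  for T :: "'w::real_vector set" and h +
  fixes F :: "'w \<Rightarrow> 'w" and z0 z1 z2 :: 'w
  assumes z_in [simp]: "z0 \<in> T" "z1 \<in> T" "z2 \<in> T"
    and h_z: "h z0 z0 = 1" "h z1 z1 = - 1" "h z2 z2 = 1" "h z0 z1 = 0" "h z0 z2 = 0" "h z1 z2 = 0"
    and F_linear: "linear_map_on T T F"
    and F_z: "F z0 = 0" "F z1 = 0" "F z2 = 0"
    and F_orth: "x \<in> T \<Longrightarrow> h (F x) z0 = 0" "x \<in> T \<Longrightarrow> h (F x) z1 = 0" "x \<in> T \<Longrightarrow> h (F x) z2 = 0"
    and F_selfadjoint: "x \<in> T \<Longrightarrow> y \<in> T \<Longrightarrow> h (F x) y = h x (F y)"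
    and F_F: "x \<in> T \<Longrightarrow> F (F x) = - x + h x z0 *\<^sub>R z0 - h x z1 *\<^sub>R z1 + h x z2 *\<^sub>R z2"
begin

lemma F_simps [simp]:
  assumes "x \<in> T"
  shows "F x \<in> T" "y \<in> T \<Longrightarrow> F (x + y) = F x + F y" "F (r *\<^sub>R x) = r *\<^sub>R F x"
  using linear_map_onD[OF F_linear] assms by simp_all

lemma h_z': "h z1 z0 = 0" "h z2 z0 = 0" "h z2 z1 = 0"
  using h_z form_sym[of z0 z1] form_sym[of z0 z2] form_sym[of z1 z2] by simp_all

text \<open>\<open>zt\<close>, \<open>et\<close> and \<open>Ft\<close> are \<xi>, \<eta> and \<phi>
  at one point, so \<open>t0\<close> and \<open>t2\<close> are real numbers here; the forms
  \<open>\<eta>0\<close>, \<open>\<eta>1\<close>, \<open>\<eta>2\<close> enter as products with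
  \<open>z0\<close>, \<open>z1\<close>, \<open>z2\<close>.\<close>

definition zt :: "real \<Rightarrow> real \<Rightarrow> 'w" where
  "zt t0 t2 = t0 *\<^sub>R z0 - t2 *\<^sub>R z2"

definition et :: "real \<Rightarrow> real \<Rightarrow> 'w \<Rightarrow> real" where
  "et t0 t2 x = t0 * h x z0 - t2 * h x z2"

definition Ft :: "real \<Rightarrow> real \<Rightarrow> 'w \<Rightarrow> 'w" where
  "Ft t0 t2 x = F x + t0 *\<^sub>R (h x z1 *\<^sub>R z2 + h x z2 *\<^sub>R z1) + t2 *\<^sub>R (h x z0 *\<^sub>R z1 + h x z1 *\<^sub>R z0)"

lemma zt_in [simp]: "zt t0 t2 \<in> T"
  by (simp add: zt_def)

lemma Ft_in [simp]: "x \<in> T \<Longrightarrow> Ft t0 t2 x \<in> T"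
  by (simp add: Ft_def)

lemma linear_map_on_et: "linear_map_on T UNIV (et t0 t2)"
  by (simp add: linear_map_on_def et_def algebra_simps)

lemma linear_map_on_Ft: "linear_map_on T T (Ft t0 t2)"
  unfolding linear_map_on_def
proof (intro conjI ballI allI)
  fix x y assume "x \<in> T" "y \<in> T"
  then show "Ft t0 t2 (x + y) = Ft t0 t2 x + Ft t0 t2 y"
    by (simp add: Ft_def scaleR_add_left scaleR_add_right)
next
  fix r x assume "x \<in> T"
  then show "Ft t0 t2 (r *\<^sub>R x) = r *\<^sub>R Ft t0 t2 x"
    by (simp add: Ft_def scaleR_add_right ac_simps)
qed simp

text \<open>\<open>z0\<close> and \<open>z2\<close> both have square \<open>1\<close>, so the value
  is \<open>t0\<^sup>2 + t2\<^sup>2\<close>; this is why the parameters lie on a circle and not on a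
  hyperbola.\<close>

lemma et_zt: "t0\<^sup>2 + t2\<^sup>2 = 1 \<Longrightarrow> et t0 t2 (zt t0 t2) = 1"
  by (simp add: et_def zt_def h_z h_z' power2_eq_square)

lemma h_zt: "x \<in> T \<Longrightarrow> h x (zt t0 t2) = et t0 t2 x"
  by (simp add: et_def zt_def)

lemma Ft_Ft:
  assumes x: "x \<in> T" and t: "t0\<^sup>2 + t2\<^sup>2 = 1"
  shows "Ft t0 t2 (Ft t0 t2 x) = - x + et t0 t2 x *\<^sub>R zt t0 t2"
proof -
  define a0 a1 a2 where "a0 = h x z0" "a1 = h x z1" "a2 = h x z2"
  let ?y = "Ft t0 t2 x"
  \<comment> \<open>\<open>F x\<close> is orthogonal to all three vectors and contributes nothing;
    the minus sign comes from \<open>h z1 z1 = - 1\<close>.\<close>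
  have coords: "h ?y z0 = t2 * a1" "h ?y z1 = - (t0 * a2 + t2 * a0)" "h ?y z2 = t0 * a1"
    using x by (simp_all add: Ft_def a0_a1_a2_def F_orth h_z h_z' algebra_simps)
  have "F ?y = F (F x)"
    using x by (simp add: Ft_def F_z)
  then have "Ft t0 t2 ?y = - x + a0 *\<^sub>R z0 - a1 *\<^sub>R z1 + a2 *\<^sub>R z2
      + t0 *\<^sub>R (- (t0 * a2 + t2 * a0) *\<^sub>R z2 + (t0 * a1) *\<^sub>R z1)
      + t2 *\<^sub>R ((t2 * a1) *\<^sub>R z1 + - (t0 * a2 + t2 * a0) *\<^sub>R z0)"
    by (simp add: Ft_def[of t0 t2 ?y] coords F_F[OF x] a0_a1_a2_def)
  also have "\<dots> = - x + (a0 - t2 * (t0 * a2 + t2 * a0)) *\<^sub>R z0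
      + (t0 * t0 * a1 + t2 * t2 * a1 - a1) *\<^sub>R z1 + (a2 - t0 * (t0 * a2 + t2 * a0)) *\<^sub>R z2"
    by (simp add: algebra_simps)
  \<comment> \<open>Multiplying \<open>a0\<close> by \<open>t0\<^sup>2 + t2\<^sup>2\<close> cancels
    the quadratic term in \<open>t2\<close> and leaves the common factor \<open>t0\<close>. The
    coefficient of \<open>z2\<close> is treated in the same way.\<close>
  also have "a0 - t2 * (t0 * a2 + t2 * a0) = t0 * et t0 t2 x"
  proof -
    have "a0 = (t0\<^sup>2 + t2\<^sup>2) * a0" using t by simp
    then show ?thesis by (simp add: et_def a0_a1_a2_def power2_eq_square algebra_simps)
  qed
  also have "t0 * t0 * a1 + t2 * t2 * a1 - a1 = 0"
    using t by (simp add: power2_eq_square flip: distrib_right)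
  also have "a2 - t0 * (t0 * a2 + t2 * a0) = - t2 * et t0 t2 x"
  proof -
    have "a2 = (t0\<^sup>2 + t2\<^sup>2) * a2" using t by simp
    then show ?thesis by (simp add: et_def a0_a1_a2_def power2_eq_square algebra_simps)
  qed
  finally show ?thesis
    by (simp add: zt_def algebra_simps)
qed

text \<open>The terms added to \<open>F\<close> are symmetric under exchanging \<open>z1\<close>
  with \<open>z2\<close> and \<open>z0\<close> with \<open>z1\<close> respectively, so they are
  self-adjoint like \<open>F\<close>.\<close>

lemma Ft_selfadjoint:
  assumes "x \<in> T" "y \<in> T"
  shows "h (Ft t0 t2 x) y = h x (Ft t0 t2 y)"
  using assms by (simp add: Ft_def F_selfadjoint form_sym[of z0 y] form_sym[of z1 y] form_sym[of z2 y] algebra_simps)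

lemma Ft_norden:
  assumes x: "x \<in> T" and y: "y \<in> T" and t: "t0\<^sup>2 + t2\<^sup>2 = 1"
  shows "h (Ft t0 t2 x) (Ft t0 t2 y) = - h x y + et t0 t2 x * et t0 t2 y"
  using Ft_selfadjoint[of x "Ft t0 t2 y"] x y by (simp add: Ft_Ft[OF y t] h_zt)

end

text \<open>One point of the submanifold: \<open>\<iota>\<close> is the inclusion, needed because
  tangent vectors of M and of the ambient manifold have different types. \<open>tang\<close>,
  \<open>c1\<close> and \<open>c2\<close> are known only through \<open>decomp\<close>, which keeps
  the definite description out of the algebra.\<close>

locale framed_subspace = norden_space V g \<phi> \<xi> \<eta>
  for V :: "'v::real_vector set" and g \<phi> \<xi> \<eta> +
  fixes T :: "'w::real_vector set" and \<iota> :: "'w \<Rightarrow> 'v" and N1 N2 :: 'v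
    and tang :: "'v \<Rightarrow> 'w" and c1 c2 :: "'v \<Rightarrow> real"
  assumes subspace_T: "subspace T" and iota_linear: "linear_map_on T V \<iota>" and iota_inj: "inj_on \<iota> T"
    and N_in [simp]: "N1 \<in> V" "N2 \<in> V"
    and N_orth: "x \<in> T \<Longrightarrow> g (\<iota> x) N1 = 0" "x \<in> T \<Longrightarrow> g (\<iota> x) N2 = 0"
    and N_N: "g N1 N1 = 1" "g N2 N2 = - 1" "g N1 N2 = 0"
    and tang_in [simp]: "w \<in> V \<Longrightarrow> tang w \<in> T"
    and decomp: "w \<in> V \<Longrightarrow> w = \<iota> (tang w) + c1 w *\<^sub>R N1 + c2 w *\<^sub>R N2"
    and N_phi_N: "g N1 (\<phi> N1) = 0" "g N1 (\<phi> N2) = 0" "g N2 (\<phi> N1) = 0" "g N2 (\<phi> N2) = 0"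
    and N_xi: "g N1 \<xi> = 0" "g N2 \<xi> = 0"
begin

lemmas T_closed [simp] = subspace_add[OF subspace_T] subspace_scale[OF subspace_T]
  subspace_neg[OF subspace_T] subspace_diff[OF subspace_T]

lemma iota_simps [simp]:
  assumes "x \<in> T"
  shows "\<iota> x \<in> V" "y \<in> T \<Longrightarrow> \<iota> (x + y) = \<iota> x + \<iota> y" "y \<in> T \<Longrightarrow> \<iota> (x - y) = \<iota> x - \<iota> y"
    "\<iota> (- x) = - \<iota> x" "\<iota> (r *\<^sub>R x) = r *\<^sub>R \<iota> x"
  using linear_map_onD[OF iota_linear] assms linear_map_on_minus[OF subspace_T iota_linear]
    linear_map_on_diff[OF subspace_T iota_linear] by simp_all

lemma c1_eq: "w \<in> V \<Longrightarrow> c1 w = g w N1"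
proof -
  assume w: "w \<in> V"
  have "g w N1 = g (\<iota> (tang w) + c1 w *\<^sub>R N1 + c2 w *\<^sub>R N2) N1" using decomp[OF w] by simp
  then show ?thesis using w N_N form_sym[of N1 N2] by (simp add: N_orth)
qed

lemma c2_eq: "w \<in> V \<Longrightarrow> c2 w = - g w N2"
proof -
  assume w: "w \<in> V"
  have "g w N2 = g (\<iota> (tang w) + c1 w *\<^sub>R N1 + c2 w *\<^sub>R N2) N2" using decomp[OF w] by simp
  then show ?thesis using w N_N by (simp add: N_orth)
qed

text \<open>Orthogonal projection along the normal plane; the sign of the last term reflects
  \<open>g N2 N2 = - 1\<close>. With \<open>T_eqI\<close> it moves identities between tangential
  parts into the ambient space.\<close>

lemma iota_tang: "w \<in> V \<Longrightarrow> \<iota> (tang w) = w - g w N1 *\<^sub>R N1 + g w N2 *\<^sub>R N2"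
  using decomp[of w] by (simp add: c1_eq c2_eq algebra_simps)

lemma T_eqI: "x \<in> T \<Longrightarrow> y \<in> T \<Longrightarrow> \<iota> x = \<iota> y \<Longrightarrow> x = y"
  using iota_inj by (auto dest: inj_onD)

definition "ind_h x y = g (\<iota> x) (\<iota> y)"
definition "ind_F x = tang (\<phi> (\<iota> x))"
definition "ind_z0 = tang \<xi>"
definition "ind_z1 = tang (\<phi> N1)"
text \<open>The minus sign compensates \<open>g N2 N2 = - 1\<close>: it makes the second normal
  coefficient of \<open>\<phi> (\<iota> x)\<close> equal to \<open>ind_h x ind_z2\<close> without a
  sign.\<close>

definition "ind_z2 = - tang (\<phi> N2)"

text \<open>Conditions (ii) and (iii) make the normal coefficients vanish, so the projection changes
  none of these vectors.\<close>

lemma iota_z: "\<iota> ind_z0 = \<xi>" "\<iota> ind_z1 = \<phi> N1" "\<iota> ind_z2 = - \<phi> N2"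
  using N_xi N_phi_N by (simp_all add: ind_z0_def ind_z1_def ind_z2_def iota_tang form_sym[of _ N1] form_sym[of _ N2])

lemma ind_z_in [simp]: "ind_z0 \<in> T" "ind_z1 \<in> T" "ind_z2 \<in> T"
  by (simp_all add: ind_z0_def ind_z1_def ind_z2_def)

lemma ind_F_in [simp]: "x \<in> T \<Longrightarrow> ind_F x \<in> T"
  by (simp add: ind_F_def)

lemma ind_h_z1: "x \<in> T \<Longrightarrow> ind_h x ind_z1 = g (\<phi> (\<iota> x)) N1"
  by (simp add: ind_h_def iota_z phi_selfadjoint)

lemma ind_h_z2: "x \<in> T \<Longrightarrow> ind_h x ind_z2 = - g (\<phi> (\<iota> x)) N2"
  by (simp add: ind_h_def iota_z phi_selfadjoint)

lemma iota_F: "x \<in> T \<Longrightarrow> \<iota> (ind_F x) = \<phi> (\<iota> x) - ind_h x ind_z1 *\<^sub>R N1 - ind_h x ind_z2 *\<^sub>R N2"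
  by (simp add: ind_F_def iota_tang ind_h_z1 ind_h_z2)

lemma normal_coeffs: "x \<in> T \<Longrightarrow> c1 (\<phi> (\<iota> x)) = ind_h x ind_z1" "x \<in> T \<Longrightarrow> c2 (\<phi> (\<iota> x)) = ind_h x ind_z2"
  by (simp_all add: c1_eq c2_eq ind_h_z1 ind_h_z2)

lemma eta_N: "\<eta> N1 = 0" "\<eta> N2 = 0"
  using N_xi form_xi[of N1] form_xi[of N2] by simp_all

lemma phi_phi_N: "\<phi> (\<phi> N1) = - N1" "\<phi> (\<phi> N2) = - N2"
  by (simp_all add: phi_phi eta_N)

sublocale induced: induced_structure T ind_h ind_F ind_z0 ind_z1 ind_z2
proof unfold_locales
  show "subspace T" by (rule subspace_T)
  show "linear_map_on T UNIV (ind_h x)" if "x \<in> T" for x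
    using that by (simp add: linear_map_on_def ind_h_def)
  show "ind_h x y = ind_h y x" if "x \<in> T" "y \<in> T" for x y
    using that by (simp add: ind_h_def form_sym)
  show "ind_h ind_z0 ind_z0 = 1" by (simp add: ind_h_def iota_z form_xi eta_xi)
  \<comment> \<open>The Norden identity reverses the sign of \<open>g\<close> on vectors annihilated
    by \<eta>, so these squares are opposite to those of \<open>N1\<close> and
    \<open>N2\<close>.\<close>
  show "ind_h ind_z1 ind_z1 = - 1" "ind_h ind_z2 ind_z2 = 1" "ind_h ind_z1 ind_z2 = 0"
    by (simp_all add: ind_h_def iota_z norden eta_N N_N)
  show "ind_h ind_z0 ind_z1 = 0" "ind_h ind_z0 ind_z2 = 0"
    by (simp_all add: ind_h_def iota_z form_sym[of \<xi>] form_xi eta_phi)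
  show F_z: "ind_F ind_z0 = 0" "ind_F ind_z1 = 0" "ind_F ind_z2 = 0"
  proof -
    \<comment> \<open>\<phi> kills \<open>\<iota> ind_z0\<close> and sends
      \<open>\<iota> ind_z1\<close> and \<open>\<iota> ind_z2\<close> back to the normal vectors
      \<open>- N1\<close> and \<open>N2\<close>, whose tangential parts are 0.\<close>
    have zero: "tang 0 = 0" "tang N1 = 0" "tang N2 = 0" "tang (- N1) = 0"
      using T_eqI[of "tang _" 0] subspace_0[OF subspace_T] linear_map_on_zero[OF subspace_T iota_linear]
        form_right(4)[of 0 N1 0] form_right(4)[of 0 N2 0] form_left(4)[of N1 N1 0] form_left(4)[of N2 N1 0]
      by (auto simp: iota_tang N_N form_sym[of N2 N1])
    show "ind_F ind_z0 = 0" "ind_F ind_z1 = 0" "ind_F ind_z2 = 0"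
      by (simp_all add: ind_F_def iota_z phi_xi phi_phi_N zero)
  qed
  show "linear_map_on T T ind_F"
    unfolding linear_map_on_def
  proof (intro conjI ballI allI)
    fix x y assume xy: "x \<in> T" "y \<in> T"
    show "ind_F (x + y) = ind_F x + ind_F y"
      by (rule T_eqI) (use xy in \<open>simp_all add: iota_F ind_h_def algebra_simps\<close>)
  next
    fix r x assume x: "x \<in> T"
    show "ind_F (r *\<^sub>R x) = r *\<^sub>R ind_F x"
      by (rule T_eqI) (use x in \<open>simp_all add: iota_F ind_h_def algebra_simps\<close>)
  qed simp
  \<comment> \<open>The normal components removed in \<open>iota_F\<close> are orthogonal to tangent
    vectors, so symmetry passes from \<phi> to \<open>ind_F\<close>.\<close>
  show adj: "ind_h (ind_F x) y = ind_h x (ind_F y)" if "x \<in> T" "y \<in> T" for x y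
    using that N_orth
    by (simp add: ind_h_def[of "ind_F x"] ind_h_def[of x "ind_F y"] iota_F phi_selfadjoint form_sym[of N1 "\<iota> _"] form_sym[of N2 "\<iota> _"])
  have h0: "ind_h x 0 = 0" if "x \<in> T" for x
    using that form_right(4)[of "\<iota> x" 0 0] linear_map_on_zero[OF subspace_T iota_linear] by (simp add: ind_h_def)
  show "ind_h (ind_F x) ind_z0 = 0" "ind_h (ind_F x) ind_z1 = 0" "ind_h (ind_F x) ind_z2 = 0"
    if "x \<in> T" for x
    using that by (simp_all add: adj F_z h0)
  show "ind_F (ind_F x) = - x + ind_h x ind_z0 *\<^sub>R ind_z0 - ind_h x ind_z1 *\<^sub>R ind_z1 + ind_h x ind_z2 *\<^sub>R ind_z2"
    if x: "x \<in> T" for x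
  proof (rule T_eqI)
    have "\<iota> (ind_F (ind_F x)) = \<phi> (\<iota> (ind_F x))"
      using x by (simp add: iota_F[of "ind_F x"] adj F_z h0)
    also have "\<dots> = - \<iota> x + \<eta> (\<iota> x) *\<^sub>R \<xi> - ind_h x ind_z1 *\<^sub>R \<phi> N1 - ind_h x ind_z2 *\<^sub>R \<phi> N2"
      using x by (simp add: iota_F phi_phi)
    also have "\<eta> (\<iota> x) = ind_h x ind_z0"
      using x by (simp add: ind_h_def iota_z form_xi)
    finally show "\<iota> (ind_F (ind_F x)) =
        \<iota> (- x + ind_h x ind_z0 *\<^sub>R ind_z0 - ind_h x ind_z1 *\<^sub>R ind_z1 + ind_h x ind_z2 *\<^sub>R ind_z2)"
      using x by (simp add: iota_z)
  qed (use x in simp_all)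
qed (simp_all)

end


section \<open>Charts and tangent spaces\<close>

text \<open>With \<open>h\<close> a coordinate map, a map on a tangent space becomes linear on the
  whole model space, the form required by the calculus of linear families.\<close>

lemma linear_map_on_linear_comp:
  assumes "linear_map_on V W f" "linear h" "\<And>u. h u \<in> V"
  shows "linear (\<lambda>u. f (h u))"
  using assms(1,3) unfolding linear_map_on_def
  by (intro linearI) (simp_all add: linear_add[OF assms(2)] linear_cmul[OF assms(2)])

lemma atlas_charts_atI: "c \<in> atlas M \<Longrightarrow> p \<in> fst c \<Longrightarrow> c \<in> charts_at M p"
  by (simp add: charts_at_def)

lemma charts_atD: "c \<in> charts_at M p \<Longrightarrow> c \<in> atlas M" "c \<in> charts_at M p \<Longrightarrow> p \<in> fst c"
  by (simp_all add: charts_at_def)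

lemma tangent_spaceD:
  assumes "X \<in> tangent_space M p"
  shows "c \<in> charts_at M p \<Longrightarrow> d \<in> charts_at M p \<Longrightarrow>
      X d = frechet_derivative (transition c d) (at (snd c p)) (X c)"
    and "c \<notin> charts_at M p \<Longrightarrow> X c = 0"
  using assms unfolding tangent_space_def by blast+

lemma tangent_spaceI:
  assumes "\<And>c d. c \<in> charts_at M p \<Longrightarrow> d \<in> charts_at M p \<Longrightarrow>
      X d = frechet_derivative (transition c d) (at (snd c p)) (X c)"
    and "\<And>c. c \<notin> charts_at M p \<Longrightarrow> X c = 0"
  shows "X \<in> tangent_space M p"
  using assms unfolding tangent_space_def by blast

context
  fixes M :: "('a, 'e::euclidean_space) manifold"
  assumes M: "smooth_manifold M"
begin

lemma ex_chart_at: "p \<in> points M \<Longrightarrow> \<exists>c. c \<in> charts_at M p"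
proof -
  assume "p \<in> points M"
  moreover have "(\<Union>c\<in>atlas M. fst c) = points M" using M by (simp add: smooth_manifold_def)
  ultimately obtain c where "c \<in> atlas M" "p \<in> fst c" by (metis UN_E)
  then show ?thesis using atlas_charts_atI by metis
qed

lemma chart_subset_points: "c \<in> atlas M \<Longrightarrow> fst c \<subseteq> points M"
  using M unfolding smooth_manifold_def by (metis UN_upper)

lemma charts_at_points: "c \<in> charts_at M p \<Longrightarrow> p \<in> points M"
  by (rule subsetD[OF chart_subset_points[OF charts_atD(1)] charts_atD(2)])

lemma openin_chart: "c \<in> atlas M \<Longrightarrow> openin (mtop M) (fst c)"
  using M by (simp add: smooth_manifold_def)

lemma open_chart_image: "c \<in> atlas M \<Longrightarrow> open (snd c ` fst c)"
  using M by (simp add: smooth_manifold_def)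

lemma inj_on_chart:
  assumes c: "c \<in> atlas M" shows "inj_on (snd c) (fst c)"
proof -
  have "homeomorphic_map (subtopology (mtop M) (fst c)) (top_of_set (snd c ` fst c)) (snd c)"
    using M c by (simp add: smooth_manifold_def)
  from homeomorphic_imp_injective_map[OF this] show ?thesis
    using chart_subset_points[OF c] by (simp add: points_def Int_absorb1)
qed

lemma chart_inv_chart: "c \<in> atlas M \<Longrightarrow> p \<in> fst c \<Longrightarrow> chart_inv c (snd c p) = p"
  by (simp add: chart_inv_def inj_on_chart)

lemma open_chart_image_Int:
  assumes c: "c \<in> atlas M" and U: "openin (mtop M) U"
  shows "open (snd c ` (fst c \<inter> U))"
proof -
  have "homeomorphic_map (subtopology (mtop M) (fst c)) (top_of_set (snd c ` fst c)) (snd c)"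
    using M c by (simp add: smooth_manifold_def)
  then have "open_map (subtopology (mtop M) (fst c)) (top_of_set (snd c ` fst c)) (snd c)"
    by (rule homeomorphic_imp_open_map)
  moreover have "openin (subtopology (mtop M) (fst c)) (fst c \<inter> U)"
    using U by (auto simp: openin_subtopology)
  ultimately have "openin (top_of_set (snd c ` fst c)) (snd c ` (fst c \<inter> U))"
    unfolding open_map_def by blast
  then show ?thesis
    using openin_open_eq[OF open_chart_image[OF c]] by blast
qed

lemma transition_has_derivative:
  assumes "c \<in> charts_at M p" "d \<in> charts_at M p"
  shows "(transition c d has_derivative frechet_derivative (transition c d) (at (snd c p))) (at (snd c p))"
proof (rule smooth_on_has_derivative)
  show "smooth_on (snd c ` (fst c \<inter> fst d)) (transition c d)"
    using M charts_atD(1)[OF assms(1)] charts_atD(1)[OF assms(2)] by (simp add: smooth_manifold_def)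
  show "snd c p \<in> snd c ` (fst c \<inter> fst d)" using charts_atD(2)[OF assms(1)] charts_atD(2)[OF assms(2)] by simp
qed

lemma linear_transition_derivative:
  "c \<in> charts_at M p \<Longrightarrow> d \<in> charts_at M p \<Longrightarrow>
    linear (frechet_derivative (transition c d) (at (snd c p)))"
  by (rule has_derivative_linear[OF transition_has_derivative])

text \<open>Chain rule for a change of charts, valid because the two coordinate expressions agree on
  the open overlap. Taking \<open>f\<close> to be a coordinate map yields both the cocycle rule and
  the independence of the differential from the chart.\<close>

lemma chart_change_derivative:
  fixes f :: "'a \<Rightarrow> 'b::real_normed_vector"
  assumes c: "c \<in> charts_at M p" and d: "d \<in> charts_at M p"
    and f: "(f \<circ> chart_inv d) differentiable (at (snd d p))"
  shows "frechet_derivative (f \<circ> chart_inv c) (at (snd c p)) v =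
    frechet_derivative (f \<circ> chart_inv d) (at (snd d p)) (frechet_derivative (transition c d) (at (snd c p)) v)"
proof -
  note cd = charts_atD[OF c] charts_atD[OF d]
  have tp: "transition c d (snd c p) = snd d p"
    using cd by (simp add: transition_def chart_inv_chart)
  have "(f \<circ> chart_inv d has_derivative frechet_derivative (f \<circ> chart_inv d) (at (snd d p)))
      (at (transition c d (snd c p)))"
    unfolding tp using f by (simp add: frechet_derivative_works)
  from diff_chain_at[OF transition_has_derivative[OF c d] this]
  have "((f \<circ> chart_inv d) \<circ> transition c d has_derivative
     frechet_derivative (f \<circ> chart_inv d) (at (snd d p)) \<circ>
       frechet_derivative (transition c d) (at (snd c p))) (at (snd c p))" .
  then have "(f \<circ> chart_inv c has_derivative
     frechet_derivative (f \<circ> chart_inv d) (at (snd d p)) \<circ>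
       frechet_derivative (transition c d) (at (snd c p))) (at (snd c p))"
  proof (rule has_derivative_transform_within_open)
    show "open (snd c ` (fst c \<inter> fst d))"
      by (intro open_chart_image_Int openin_chart cd)
    show "snd c p \<in> snd c ` (fst c \<inter> fst d)" using cd by blast
    show "(f \<circ> chart_inv d \<circ> transition c d) x = (f \<circ> chart_inv c) x"
      if "x \<in> snd c ` (fst c \<inter> fst d)" for x
      using that cd by (auto simp: transition_def chart_inv_chart)
  qed
  from frechet_derivative_at[OF this] show ?thesis by (simp add: fun_eq_iff)
qed

lemma transition_cocycle:
  assumes "c \<in> charts_at M p" "d \<in> charts_at M p" "e \<in> charts_at M p"
  shows "frechet_derivative (transition c e) (at (snd c p)) v =
    frechet_derivative (transition d e) (at (snd d p)) (frechet_derivative (transition c d) (at (snd c p)) v)"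
  unfolding transition_def[of c e] transition_def[of d e]
  by (rule chart_change_derivative[OF assms(1,2)],
      fold transition_def, rule differentiableI[OF transition_has_derivative[OF assms(2,3)]])

lemma transition_refl:
  assumes c: "c \<in> charts_at M p"
  shows "frechet_derivative (transition c c) (at (snd c p)) v = v"
proof -
  note cd = charts_atD[OF c]
  have "(transition c c has_derivative (\<lambda>v. v)) (at (snd c p))"
  proof (rule has_derivative_transform_within_open[OF has_derivative_ident])
    show "open (snd c ` fst c)" by (rule open_chart_image[OF cd(1)])
    show "snd c p \<in> snd c ` fst c" using cd by blast
    show "x = transition c c x" if "x \<in> snd c ` fst c" for x
      using that cd by (auto simp: transition_def chart_inv_chart)
  qed
  from frechet_derivative_at[OF this] show ?thesis by (simp add: fun_eq_iff)
qed

lemma coord_vector_in_tangent_space: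
  "c \<in> charts_at M p \<Longrightarrow> coord_vector M c p u \<in> tangent_space M p"
  by (rule tangent_spaceI) (simp_all add: coord_vector_def transition_cocycle[symmetric])

lemma coord_vector_coord: "c \<in> charts_at M p \<Longrightarrow> coord_vector M c p u c = u"
  by (simp add: coord_vector_def transition_refl)

lemma tangent_vector_eq_coord_vector:
  assumes "X \<in> tangent_space M p" "c \<in> charts_at M p"
  shows "coord_vector M c p (X c) = X"
proof
  fix d
  show "coord_vector M c p (X c) d = X d"
  proof (cases "d \<in> charts_at M p")
    case True
    from tangent_spaceD(1)[OF assms this] show ?thesis using True by (simp add: coord_vector_def)
  next
    case False
    from tangent_spaceD(2)[OF assms(1) this] show ?thesis using False by (simp add: coord_vector_def)
  qed
qed

text \<open>\<open>coord_vector\<close> rebuilds a tangent vector from any single coordinate, so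
  equations between tangent vectors need checking in one chart only.\<close>

lemma tangent_vector_eqI:
  assumes "X \<in> tangent_space M p" "Y \<in> tangent_space M p" "c \<in> charts_at M p" "X c = Y c"
  shows "X = Y"
proof -
  have "X = coord_vector M c p (Y c)"
    by (rule tangent_vector_eq_coord_vector[OF assms(1,3), symmetric, unfolded assms(4)])
  also have "\<dots> = Y"
    by (rule tangent_vector_eq_coord_vector[OF assms(2,3)])
  finally show ?thesis .
qed

lemma linear_coord_vector: "c \<in> charts_at M p \<Longrightarrow> linear (coord_vector M c p)"
  using linear_transition_derivative
  by (intro linearI) (simp_all add: coord_vector_def fun_eq_iff linear_add linear_cmul)

lemma subspace_tangent_space: "subspace (tangent_space M p)"
proof (rule subspaceI)
  note lin = linear_transition_derivative
  show "0 \<in> tangent_space M p"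
    by (rule tangent_spaceI) (simp_all add: linear_0[OF lin])
  show "X + Y \<in> tangent_space M p" if "X \<in> tangent_space M p" "Y \<in> tangent_space M p" for X Y
  proof (rule tangent_spaceI)
    fix c d assume cd: "c \<in> charts_at M p" "d \<in> charts_at M p"
    show "(X + Y) d = frechet_derivative (transition c d) (at (snd c p)) ((X + Y) c)"
      using tangent_spaceD(1)[OF that(1) cd] tangent_spaceD(1)[OF that(2) cd]
      by (simp add: linear_add[OF lin[OF cd]])
  qed (simp add: tangent_spaceD(2)[OF that(1)] tangent_spaceD(2)[OF that(2)])
  show "r *\<^sub>R X \<in> tangent_space M p" if "X \<in> tangent_space M p" for r X
  proof (rule tangent_spaceI)
    fix c d assume cd: "c \<in> charts_at M p" "d \<in> charts_at M p"
    show "(r *\<^sub>R X) d = frechet_derivative (transition c d) (at (snd c p)) ((r *\<^sub>R X) c)"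
      using tangent_spaceD(1)[OF that cd] by (simp add: linear_cmul[OF lin[OF cd]])
  qed (simp add: tangent_spaceD(2)[OF that])
qed

end


section \<open>The differential of the inclusion\<close>

context
  fixes M :: "('a, 'f::euclidean_space) manifold" and N :: "('a, 'e::euclidean_space) manifold"
  assumes sub: "submanifold M N"
begin

lemma submanifoldD:
  "smooth_manifold M" "smooth_manifold N" "points M \<subseteq> points N" "smooth_map M N (\<lambda>p. p)"
  "p \<in> points M \<Longrightarrow> inj_on (incl M N p) (tangent_space M p)"
  using sub by (simp_all add: submanifold_def immersion_def incl_def)

text \<open>Continuity of the inclusion makes the trace of an ambient chart domain open in the
  topology of \<open>M\<close>, even when that topology is finer than the subspace topology.\<close>

lemma open_chart_image_overlap:
  assumes "c \<in> atlas M" "d \<in> atlas N"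
  shows "open (snd c ` (fst c \<inter> fst d))"
proof -
  have "openin (mtop M) {p \<in> topspace (mtop M). p \<in> fst d}"
    using openin_continuous_map_preimage submanifoldD(4) openin_chart[OF submanifoldD(2) assms(2)]
    unfolding smooth_map_def by blast
  then have "open (snd c ` (fst c \<inter> {p \<in> topspace (mtop M). p \<in> fst d}))"
    by (rule open_chart_image_Int[OF submanifoldD(1) assms(1)])
  moreover have "fst c \<inter> {p \<in> topspace (mtop M). p \<in> fst d} = fst c \<inter> fst d"
    using chart_subset_points[OF submanifoldD(1) assms(1)] by (auto simp: points_def)
  ultimately show ?thesis by simp
qed

lemma smooth_on_inclusion:
  assumes "c \<in> atlas M" "d \<in> atlas N"
  shows "smooth_on (snd c ` (fst c \<inter> fst d)) (snd d \<circ> chart_inv c)"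
  using submanifoldD(4) assms unfolding smooth_map_def by (auto simp: o_def)

lemma inclusion_has_derivative:
  assumes "c \<in> charts_at M p" "d \<in> charts_at N p"
  shows "(snd d \<circ> chart_inv c has_derivative frechet_derivative (snd d \<circ> chart_inv c) (at (snd c p))) (at (snd c p))"
  using smooth_on_has_derivative[OF smooth_on_inclusion] charts_atD[OF assms(1)] charts_atD[OF assms(2)] by blast

text \<open>\<open>differential\<close> works in a chart picked by \<open>SOME\<close>; the
  transformation law of \<open>X\<close> and the chain rule cancel that choice.\<close>

lemma incl_coord:
  assumes X: "X \<in> tangent_space M p" and c: "c \<in> charts_at M p" and d: "d \<in> charts_at N p"
  shows "incl M N p X d = frechet_derivative (snd d \<circ> chart_inv c) (at (snd c p)) (X c)"
proof -
  define c' where "c' = (SOME c. c \<in> charts_at M p)"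
  have c': "c' \<in> charts_at M p" unfolding c'_def using c by (rule someI)
  have "incl M N p X d = frechet_derivative (snd d \<circ> chart_inv c') (at (snd c' p)) (X c')"
    using d by (simp add: incl_def differential_def c'_def o_def Let_def)
  also have "X c' = frechet_derivative (transition c c') (at (snd c p)) (X c)"
    by (rule tangent_spaceD(1)[OF X c c'])
  finally show ?thesis
    using chart_change_derivative[OF submanifoldD(1) c c', of "snd d"] inclusion_has_derivative[OF c' d]
    unfolding differentiable_def by metis
qed

lemma incl_outside: "d \<notin> charts_at N p \<Longrightarrow> incl M N p X d = 0"
  by (simp add: incl_def differential_def Let_def)

lemma incl_in_tangent_space:
  assumes p: "p \<in> points M" and X: "X \<in> tangent_space M p"
  shows "incl M N p X \<in> tangent_space N p"
proof (rule tangent_spaceI)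
  fix d e assume d: "d \<in> charts_at N p" and e: "e \<in> charts_at N p"
  obtain c where c: "c \<in> charts_at M p" using ex_chart_at[OF submanifoldD(1) p] by blast
  note cd = charts_atD[OF c] charts_atD[OF d] charts_atD[OF e]
  let ?D = frechet_derivative
  have eq: "(snd d \<circ> chart_inv c) (snd c p) = snd d p"
    using cd by (simp add: chart_inv_chart[OF submanifoldD(1)])
  have "(transition d e \<circ> (snd d \<circ> chart_inv c) has_derivative
     ?D (transition d e) (at (snd d p)) \<circ> ?D (snd d \<circ> chart_inv c) (at (snd c p))) (at (snd c p))"
    by (rule diff_chain_at[OF inclusion_has_derivative[OF c d]])
       (use transition_has_derivative[OF submanifoldD(2) d e] eq in simp)
  then have "(snd e \<circ> chart_inv c has_derivative
     ?D (transition d e) (at (snd d p)) \<circ> ?D (snd d \<circ> chart_inv c) (at (snd c p))) (at (snd c p))"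
  proof (rule has_derivative_transform_within_open)
    show "open (snd c ` (fst c \<inter> fst d))"
      by (intro open_chart_image_overlap cd)
    show "snd c p \<in> snd c ` (fst c \<inter> fst d)" using cd by blast
    show "(transition d e \<circ> (snd d \<circ> chart_inv c)) x = (snd e \<circ> chart_inv c) x"
      if "x \<in> snd c ` (fst c \<inter> fst d)" for x
      using that cd
      by (auto simp: transition_def chart_inv_chart[OF submanifoldD(1)] chart_inv_chart[OF submanifoldD(2)])
  qed
  from frechet_derivative_at[OF this, symmetric]
  show "incl M N p X e = ?D (transition d e) (at (snd d p)) (incl M N p X d)"
    using incl_coord[OF X c d] incl_coord[OF X c e] by simp
qed (rule incl_outside)

lemma linear_map_on_incl:
  assumes p: "p \<in> points M"
  shows "linear_map_on (tangent_space M p) (tangent_space N p) (incl M N p)"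
proof -
  obtain c where c: "c \<in> charts_at M p" using ex_chart_at[OF submanifoldD(1) p] by blast
  note T = subspace_tangent_space[OF submanifoldD(1), of p]
  have lin: "linear (frechet_derivative (snd d \<circ> chart_inv c) (at (snd c p)))" if "d \<in> charts_at N p" for d
    using inclusion_has_derivative[OF c that] has_derivative_linear by blast
  have "incl M N p (X + Y) d = incl M N p X d + incl M N p Y d"
    if "X \<in> tangent_space M p" "Y \<in> tangent_space M p" for X Y d
  proof (cases "d \<in> charts_at N p")
    case True
    then show ?thesis
      using that T by (simp add: incl_coord[OF _ c] subspace_add linear_add[OF lin])
  qed (simp add: incl_outside)
  moreover have "incl M N p (r *\<^sub>R X) d = r *\<^sub>R incl M N p X d"
    if "X \<in> tangent_space M p" for r X d
  proof (cases "d \<in> charts_at N p")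
    case True
    then show ?thesis
      using that T by (simp add: incl_coord[OF _ c] subspace_scale linear_cmul[OF lin])
  qed (simp add: incl_outside)
  ultimately show ?thesis
    using incl_in_tangent_space[OF p] by (auto simp: linear_map_on_def fun_eq_iff)
qed

end


section \<open>Smooth sections along a submanifold\<close>

text \<open>Here \<open>c\<close> is a chart of the submanifold, and \<open>W\<close> is considered over its domain only.\<close>

definition smooth_section ::
    "('a, 'e::euclidean_space) manifold \<Rightarrow> ('a, 'f::euclidean_space) chart \<Rightarrow>
     ('a \<Rightarrow> ('a, 'e) tangent_vector) \<Rightarrow> bool" where
  "smooth_section N c W \<longleftrightarrow>
     (\<forall>p\<in>fst c. W p \<in> tangent_space N p) \<and>
     (\<forall>d\<in>atlas N. smooth_on (snd c ` (fst c \<inter> fst d)) (\<lambda>x. W (chart_inv c x) d))"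

lemma smooth_sectionD:
  assumes "smooth_section N c W"
  shows "p \<in> fst c \<Longrightarrow> W p \<in> tangent_space N p"
    and "d \<in> atlas N \<Longrightarrow> smooth_on (snd c ` (fst c \<inter> fst d)) (\<lambda>x. W (chart_inv c x) d)"
  using assms unfolding smooth_section_def by blast+

lemma normal_space_atD:
  assumes "W \<in> normal_space_at M N g p"
  shows "W \<in> tangent_space N p" "X \<in> tangent_space M p \<Longrightarrow> g p W (incl M N p X) = 0"
  using assms by (simp_all add: normal_space_at_def)

lemma pseudo_Riemannian_symmetric_form:
  assumes "smooth_manifold M" "pseudo_Riemannian_metric M g" "p \<in> points M"
  shows "symmetric_form (tangent_space M p) (g p)"
proof
  show "subspace (tangent_space M p)" by (rule subspace_tangent_space[OF assms(1)])
  show "linear_map_on (tangent_space M p) UNIV (g p X)" if "X \<in> tangent_space M p" for X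
    using assms(2,3) that by (simp add: pseudo_Riemannian_metric_def tensor_field_0_2_def)
  show "g p X Y = g p Y X" if "X \<in> tangent_space M p" "Y \<in> tangent_space M p" for X Y
    using assms(2,3) that unfolding pseudo_Riemannian_metric_def by metis
qed

lemma pseudo_Riemannian_bilinear:
  assumes "pseudo_Riemannian_metric M g" "p \<in> points M" "X \<in> tangent_space M p"
  shows "linear_map_on (tangent_space M p) UNIV (\<lambda>Y. g p X Y)"
    "linear_map_on (tangent_space M p) UNIV (\<lambda>Y. g p Y X)"
  using assms by (simp_all add: pseudo_Riemannian_metric_def tensor_field_0_2_def)

context
  fixes M :: "('a, 'f::euclidean_space) manifold" and N :: "('a, 'e::euclidean_space) manifold"
    and c :: "('a, 'f) chart"
  assumes sub: "submanifold M N" and c: "c \<in> atlas M"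
begin

lemmas mM = submanifoldD(1)[OF sub] and mN = submanifoldD(2)[OF sub]

lemma chart_inv_in:
  assumes "x \<in> snd c ` (fst c \<inter> U)"
  shows "chart_inv c x \<in> fst c" "chart_inv c x \<in> U" "snd c (chart_inv c x) = x"
  using assms chart_inv_chart[OF mM c] by auto

lemma chart_domain_points: "p \<in> fst c \<Longrightarrow> p \<in> points M" "p \<in> fst c \<Longrightarrow> p \<in> points N"
  using subsetD[OF chart_subset_points[OF mM c]] subsetD[OF submanifoldD(3)[OF sub]] by simp_all

text \<open>In coordinates, restricting to the submanifold is composition with
  \<open>snd d \<circ> chart_inv c\<close>, which is smooth as the inclusion is.\<close>

lemma smooth_on_pullback:
  assumes d: "d \<in> atlas N" and f: "smooth_on (snd d ` fst d) (\<lambda>y. f (chart_inv d y))"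
  shows "smooth_on (snd c ` (fst c \<inter> fst d)) (\<lambda>x. f (chart_inv c x))"
proof (rule smooth_on_cong)
  show op: "open (snd c ` (fst c \<inter> fst d))" by (rule open_chart_image_overlap[OF sub c d])
  have "smooth_on (snd c ` (fst c \<inter> fst d)) (\<lambda>x. f (chart_inv d ((snd d \<circ> chart_inv c) x)))"
    by (rule smooth_on_compose[OF op _ smooth_on_inclusion[OF sub c d] f])
       (use chart_inv_in[of _ "fst d"] in auto)
  then show "smooth_on (snd c ` (fst c \<inter> fst d)) (\<lambda>x. f (chart_inv d (snd d (chart_inv c x))))"
    by simp
  show "f (chart_inv d (snd d (chart_inv c x))) = f (chart_inv c x)"
    if "x \<in> snd c ` (fst c \<inter> fst d)" for x
    using chart_inv_in(2)[OF that] by (simp add: chart_inv_chart[OF mN d])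
qed

lemma smooth_on_chart_local:
  assumes "\<And>d. d \<in> atlas N \<Longrightarrow> smooth_on (snd c ` (fst c \<inter> fst d)) f"
  shows "smooth_on (snd c ` fst c) f"
proof (rule smooth_on_local)
  fix x assume "x \<in> snd c ` fst c"
  then obtain p where p: "p \<in> fst c" "x = snd c p" by blast
  obtain d where d: "d \<in> charts_at N p"
    using ex_chart_at[OF mN chart_domain_points(2)[OF p(1)]] by blast
  note d = charts_atD[OF d]
  show "\<exists>T. open T \<and> x \<in> T \<and> smooth_on T f"
    using open_chart_image_overlap[OF sub c d(1)] assms[OF d(1)] p d(2)
    by (intro exI[of _ "snd c ` (fst c \<inter> fst d)"]) auto
qed

lemma smooth_section_vector_field:
  assumes "vector_field N X"
  shows "smooth_section N c X"
  unfolding smooth_section_def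
proof (intro conjI ballI)
  show "X p \<in> tangent_space N p" if "p \<in> fst c" for p
    using assms chart_domain_points(2)[OF that] by (simp add: vector_field_def)
  show "smooth_on (snd c ` (fst c \<inter> fst d)) (\<lambda>x. X (chart_inv c x) d)" if "d \<in> atlas N" for d
    by (rule smooth_on_pullback[OF that]) (use assms that in \<open>simp add: vector_field_def\<close>)
qed

lemma smooth_section_normal_vector_field:
  assumes "normal_vector_field M N g W"
  shows "smooth_section N c W"
  unfolding smooth_section_def
proof (intro conjI ballI)
  show "W p \<in> tangent_space N p" if "p \<in> fst c" for p
    by (rule normal_space_atD(1)[of _ M _ g])
       (use assms chart_domain_points(1)[OF that] in \<open>simp add: normal_vector_field_def\<close>)
  show "smooth_on (snd c ` (fst c \<inter> fst d)) (\<lambda>x. W (chart_inv c x) d)" if "d \<in> atlas N" for d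
    using assms c that by (simp add: normal_vector_field_def)
qed

lemma smooth_section_incl_coord_vector:
  "smooth_section N c (\<lambda>p. incl M N p (coord_vector M c p u))"
  unfolding smooth_section_def
proof (intro conjI ballI)
  show "incl M N p (coord_vector M c p u) \<in> tangent_space N p" if "p \<in> fst c" for p
    by (intro incl_in_tangent_space[OF sub] coord_vector_in_tangent_space[OF mM] chart_domain_points(1)
        atlas_charts_atI c that)
  fix d assume d: "d \<in> atlas N"
  show "smooth_on (snd c ` (fst c \<inter> fst d)) (\<lambda>x. incl M N (chart_inv c x) (coord_vector M c (chart_inv c x) u) d)"
  proof (rule smooth_on_cong[OF open_chart_image_overlap[OF sub c d]
        _ smooth_on_frechet_derivative[OF smooth_on_inclusion[OF sub c d]]])
    fix x assume x: "x \<in> snd c ` (fst c \<inter> fst d)"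
    note cp = atlas_charts_atI[OF c chart_inv_in(1)[OF x]]
    show "frechet_derivative (snd d \<circ> chart_inv c) (at x) u =
        incl M N (chart_inv c x) (coord_vector M c (chart_inv c x) u) d"
      using incl_coord[OF sub coord_vector_in_tangent_space[OF mM cp] cp
          atlas_charts_atI[OF d chart_inv_in(2)[OF x]], of u]
      by (simp add: chart_inv_in(3)[OF x] coord_vector_coord[OF mM cp])
  qed
qed

text \<open>Over an overlap \<open>W\<close> is the coordinate vector of its own smooth coordinates,
  so \<open>F\<close> acts as a linear family whose values at constant vectors are smooth.\<close>

lemma smooth_section_tensor:
  assumes F: "tensor_field_1_1 N F" and W: "smooth_section N c W"
  shows "smooth_section N c (\<lambda>p. F p (W p))"
  unfolding smooth_section_def
proof (intro conjI ballI)
  have lin: "linear_map_on (tangent_space N p) (tangent_space N p) (F p)" if "p \<in> fst c" for p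
    using F chart_domain_points(2)[OF that] by (simp add: tensor_field_1_1_def)
  show "F p (W p) \<in> tangent_space N p" if "p \<in> fst c" for p
    by (rule linear_map_onD(1)[OF lin[OF that] smooth_sectionD(1)[OF W that]])
  fix d assume d: "d \<in> atlas N"
  let ?S = "snd c ` (fst c \<inter> fst d)"
  let ?A = "\<lambda>x u. F (chart_inv c x) (coord_vector N d (chart_inv c x) u) d"
  note op = open_chart_image_overlap[OF sub c d]
  show "smooth_on ?S (\<lambda>x. F (chart_inv c x) (W (chart_inv c x)) d)"
  proof (rule smooth_on_cong[OF op])
    show "smooth_on ?S (\<lambda>x. ?A x (W (chart_inv c x) d))"
    proof (rule smooth_on_linear_family[OF op _ _ smooth_sectionD(2)[OF W d]])
      show "linear (?A x)" if x: "x \<in> ?S" for x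
      proof -
        note dp = atlas_charts_atI[OF d chart_inv_in(2)[OF x]]
        have "linear (\<lambda>u. F (chart_inv c x) (coord_vector N d (chart_inv c x) u))"
          by (rule linear_map_on_linear_comp[OF lin[OF chart_inv_in(1)[OF x]] linear_coord_vector[OF mN dp]
                coord_vector_in_tangent_space[OF mN dp]])
        from linear_add[OF this] linear_cmul[OF this] show ?thesis by (intro linearI) simp_all
      qed
      show "smooth_on ?S (\<lambda>x. ?A x u)" for u
        by (rule smooth_on_pullback[OF d]) (use F d in \<open>simp add: tensor_field_1_1_def\<close>)
    qed
    show "?A x (W (chart_inv c x) d) = F (chart_inv c x) (W (chart_inv c x)) d" if x: "x \<in> ?S" for x
      by (simp add: tangent_vector_eq_coord_vector[OF mN smooth_sectionD(1)[OF W chart_inv_in(1)[OF x]]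
            atlas_charts_atI[OF d chart_inv_in(2)[OF x]]])
  qed
qed

lemma smooth_on_metric:
  assumes g: "pseudo_Riemannian_metric N g"
    and V: "smooth_section N c V" and W: "smooth_section N c W"
  shows "smooth_on (snd c ` fst c) (\<lambda>x. g (chart_inv c x) (V (chart_inv c x)) (W (chart_inv c x)))"
proof (rule smooth_on_chart_local)
  fix d assume d: "d \<in> atlas N"
  let ?S = "snd c ` (fst c \<inter> fst d)"
  let ?p = "chart_inv c"
  let ?e = "\<lambda>x. coord_vector N d (?p x)"
  note op = open_chart_image_overlap[OF sub c d]
  note bil = pseudo_Riemannian_bilinear[OF g chart_domain_points(2)[OF chart_inv_in(1)]]
  have e: "linear (?e x)" "\<And>u. ?e x u \<in> tangent_space N (?p x)"
    "W (?p x) \<in> tangent_space N (?p x)" "?e x (V (?p x) d) = V (?p x)" "?e x (W (?p x) d) = W (?p x)"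
    if x: "x \<in> ?S" for x
  proof -
    note dp = atlas_charts_atI[OF d chart_inv_in(2)[OF x]]
    note VW = smooth_sectionD(1)[OF V chart_inv_in(1)[OF x]] smooth_sectionD(1)[OF W chart_inv_in(1)[OF x]]
    show "linear (?e x)" "\<And>u. ?e x u \<in> tangent_space N (?p x)"
      by (rule linear_coord_vector[OF mN dp], rule coord_vector_in_tangent_space[OF mN dp])
    show "W (?p x) \<in> tangent_space N (?p x)" by (rule VW)
    show "?e x (V (?p x) d) = V (?p x)" "?e x (W (?p x) d) = W (?p x)"
      by (rule tangent_vector_eq_coord_vector[OF mN VW(1) dp], rule tangent_vector_eq_coord_vector[OF mN VW(2) dp])
  qed
  \<comment> \<open>Linear families handle one slot at a time: the first argument is held at a
    constant coordinate vector, and then \<open>V\<close> is inserted there.\<close>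
  have 1: "smooth_on ?S (\<lambda>x. g (?p x) (?e x u) (W (?p x)))" for u
  proof (rule smooth_on_cong[OF op])
    show "smooth_on ?S (\<lambda>x. g (?p x) (?e x u) (?e x (W (?p x) d)))"
    proof (rule smooth_on_linear_family[OF op _ _ smooth_sectionD(2)[OF W d]])
      show "linear (\<lambda>w. g (?p x) (?e x u) (?e x w))" if x: "x \<in> ?S" for x
        by (rule linear_map_on_linear_comp[OF bil(1)[OF x e(2)[OF x]] e(1,2)[OF x]])
      show "smooth_on ?S (\<lambda>x. g (?p x) (?e x u) (?e x w))" for w
        by (rule smooth_on_pullback[OF d])
           (use g d in \<open>simp add: pseudo_Riemannian_metric_def tensor_field_0_2_def\<close>)
    qed
  qed (simp add: e)
  show "smooth_on ?S (\<lambda>x. g (?p x) (V (?p x)) (W (?p x)))"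
  proof (rule smooth_on_cong[OF op])
    show "smooth_on ?S (\<lambda>x. g (?p x) (?e x (V (?p x) d)) (W (?p x)))"
    proof (rule smooth_on_linear_family[OF op _ 1 smooth_sectionD(2)[OF V d]])
      show "linear (\<lambda>w. g (?p x) (?e x w) (W (?p x)))" if x: "x \<in> ?S" for x
        by (rule linear_map_on_linear_comp[OF bil(2)[OF x e(3)[OF x]] e(1,2)[OF x]])
    qed
  qed (simp add: e)
qed

end


section \<open>Tangential and normal parts\<close>

locale framed_submanifold =
  fixes M :: "('a, 'f::euclidean_space) manifold" and N :: "('a, 'e::euclidean_space) manifold"
    and g :: "'a \<Rightarrow> ('a, 'e) tangent_vector \<Rightarrow> ('a, 'e) tangent_vector \<Rightarrow> real"
    and N1 N2 :: "'a \<Rightarrow> ('a, 'e) tangent_vector"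
  assumes sub: "submanifold M N" and codim: "DIM('e) = DIM('f) + 2"
    and metric: "pseudo_Riemannian_metric N g"
    and normal: "normal_vector_field M N g N1" "normal_vector_field M N g N2"
    and orthonormal: "p \<in> points M \<Longrightarrow> g p (N1 p) (N1 p) = 1"
      "p \<in> points M \<Longrightarrow> g p (N2 p) (N2 p) = - 1" "p \<in> points M \<Longrightarrow> g p (N1 p) (N2 p) = 0"
begin

lemmas mfd = submanifoldD(1,2)[OF sub]

lemma points_ambient: "p \<in> points M \<Longrightarrow> p \<in> points N"
  using submanifoldD(3)[OF sub] by blast

lemma form: "p \<in> points M \<Longrightarrow> symmetric_form (tangent_space N p) (g p)"
  by (intro pseudo_Riemannian_symmetric_form mfd metric points_ambient)

lemma normal_in:
  assumes "p \<in> points M"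
  shows "N1 p \<in> tangent_space N p" "N2 p \<in> tangent_space N p"
    and "X \<in> tangent_space M p \<Longrightarrow> g p (N1 p) (incl M N p X) = 0"
    and "X \<in> tangent_space M p \<Longrightarrow> g p (N2 p) (incl M N p X) = 0"
proof -
  have N: "N1 p \<in> normal_space_at M N g p" "N2 p \<in> normal_space_at M N g p"
    using assms normal by (simp_all add: normal_vector_field_def)
  show "N1 p \<in> tangent_space N p" "N2 p \<in> tangent_space N p"
    by (rule normal_space_atD[OF N(1)], rule normal_space_atD[OF N(2)])
  show "X \<in> tangent_space M p \<Longrightarrow> g p (N1 p) (incl M N p X) = 0"
    "X \<in> tangent_space M p \<Longrightarrow> g p (N2 p) (incl M N p X) = 0"
    by (rule normal_space_atD(2)[OF N(1)], assumption, rule normal_space_atD(2)[OF N(2)])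
qed

lemma incl_in: "p \<in> points M \<Longrightarrow> X \<in> tangent_space M p \<Longrightarrow> incl M N p X \<in> tangent_space N p"
  by (rule incl_in_tangent_space[OF sub])

text \<open>Pairing with the orthonormal frame recovers the normal coefficients from
  \<open>V\<close> alone. This is the uniqueness behind both the injectivity of
  \<open>frame_map\<close> and the definite description in \<open>decomposition\<close>.\<close>

lemma coeffs_eq:
  assumes p: "p \<in> points M" and X: "X \<in> tangent_space M p"
    and V: "V = incl M N p X + a *\<^sub>R N1 p + b *\<^sub>R N2 p"
  shows "a = g p V (N1 p)" "b = - g p V (N2 p)"
proof -
  interpret symmetric_form "tangent_space N p" "g p" by (rule form[OF p])
  have in_V: "incl M N p X \<in> tangent_space N p" "N1 p \<in> tangent_space N p" "N2 p \<in> tangent_space N p"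
    using incl_in[OF p X] normal_in[OF p] by simp_all
  have orth: "g p (incl M N p X) (N1 p) = 0" "g p (incl M N p X) (N2 p) = 0"
    using normal_in(3,4)[OF p X] form_sym[OF in_V(1,2)] form_sym[OF in_V(1,3)] by simp_all
  have "g p (N2 p) (N1 p) = 0" using orthonormal(3)[OF p] form_sym[OF in_V(2,3)] by simp
  then show "a = g p V (N1 p)" "b = - g p V (N2 p)"
    using in_V by (simp_all add: V orth orthonormal[OF p])
qed

text \<open>The decomposition read in charts. The product with two copies of the reals is again a
  Euclidean space, so all three parts of the solution are treated as one unknown.\<close>

definition frame_map :: "('a, 'f) chart \<Rightarrow> ('a, 'e) chart \<Rightarrow> 'a \<Rightarrow> 'f \<times> real \<times> real \<Rightarrow> 'e" where
  "frame_map c d p = (\<lambda>(u, a, b). incl M N p (coord_vector M c p u) d + a *\<^sub>R N1 p d + b *\<^sub>R N2 p d)"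

context
  fixes c :: "('a, 'f) chart" and d :: "('a, 'e) chart" and p :: 'a
  assumes c: "c \<in> charts_at M p" and d: "d \<in> charts_at N p"
begin

lemma p_in: "p \<in> points M"
  by (rule charts_at_points[OF mfd(1) c])

lemma linear_incl_coord_vector: "linear (\<lambda>u. incl M N p (coord_vector M c p u))"
  by (rule linear_map_on_linear_comp[OF linear_map_on_incl[OF sub p_in] linear_coord_vector[OF mfd(1) c]
        coord_vector_in_tangent_space[OF mfd(1) c]])

lemma linear_frame_map: "linear (frame_map c d p)"
  by (rule linearI)
     (auto simp: frame_map_def linear_add[OF linear_incl_coord_vector] linear_cmul[OF linear_incl_coord_vector]
       scaleR_add_left scaleR_add_right)

lemma inj_frame_map: "inj (frame_map c d p)"
proof (rule injI)
  interpret symmetric_form "tangent_space N p" "g p" by (rule form[OF p_in])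
  fix v v' assume eq: "frame_map c d p v = frame_map c d p v'"
  obtain u a b where v: "v = (u, a, b)" by (cases v) auto
  obtain u' a' b' where v': "v' = (u', a', b')" by (cases v') auto
  let ?V = "\<lambda>u a b. incl M N p (coord_vector M c p u) + a *\<^sub>R N1 p + b *\<^sub>R N2 p"
  note cv = coord_vector_in_tangent_space[OF mfd(1) c]
  have in_V: "?V u a b \<in> tangent_space N p" for u a b
    using incl_in[OF p_in cv] normal_in[OF p_in] by simp
  have V_eq: "?V u a b = ?V u' a' b'"
    by (rule tangent_vector_eqI[OF mfd(2) in_V in_V d]) (use eq in \<open>simp add: frame_map_def v v'\<close>)
  have "a = g p (?V u a b) (N1 p)" "b = - g p (?V u a b) (N2 p)"
    by (rule coeffs_eq[OF p_in cv refl])+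
  with coeffs_eq[OF p_in cv V_eq] have ab: "a = a'" "b = b'"
    by simp_all
  with V_eq have "incl M N p (coord_vector M c p u) = incl M N p (coord_vector M c p u')" by simp
  then have "coord_vector M c p u = coord_vector M c p u'"
    using submanifoldD(5)[OF sub p_in] cv by (auto dest: inj_onD)
  then have "u = u'" using coord_vector_coord[OF mfd(1) c] by metis
  with ab show "v = v'" by (simp add: v v')
qed

lemma bij_frame_map: "bij (frame_map c d p)"
proof -
  have "surj (frame_map c d p)"
    by (rule linear_injective_imp_surjective[OF linear_frame_map inj_frame_map]) (simp add: codim)
  with inj_frame_map show ?thesis by (simp add: bij_def)
qed

end

text \<open>Surjectivity of \<open>frame_map\<close> in one pair of charts provides a candidate;
  \<open>coeffs_eq\<close> and injectivity of the inclusion make it the only one, so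
  \<open>THE\<close> denotes it.\<close>

lemma decomposition_props:
  assumes p: "p \<in> points M" and V: "V \<in> tangent_space N p"
  defines "X \<equiv> tangential_part M N p (N1 p) (N2 p) V"
    and "a \<equiv> normal_coeff1 M N p (N1 p) (N2 p) V"
    and "b \<equiv> normal_coeff2 M N p (N1 p) (N2 p) V"
  shows "X \<in> tangent_space M p" "V = incl M N p X + a *\<^sub>R N1 p + b *\<^sub>R N2 p"
proof -
  interpret symmetric_form "tangent_space N p" "g p" by (rule form[OF p])
  obtain c where c: "c \<in> charts_at M p" using ex_chart_at[OF mfd(1) p] by blast
  obtain d where d: "d \<in> charts_at N p" using ex_chart_at[OF mfd(2) points_ambient[OF p]] by blast
  let ?P = "\<lambda>(X, a, b). X \<in> tangent_space M p \<and> V = incl M N p X + a *\<^sub>R N1 p + b *\<^sub>R N2 p"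
  obtain w where w: "V d = frame_map c d p w"
    using bij_is_surj[OF bij_frame_map[OF c d]] by (metis surjD)
  obtain u a0 b0 where w_eq: "w = (u, a0, b0)" by (cases w) auto
  note cv = coord_vector_in_tangent_space[OF mfd(1) c]
  have "V = incl M N p (coord_vector M c p u) + a0 *\<^sub>R N1 p + b0 *\<^sub>R N2 p"
    by (rule tangent_vector_eqI[OF mfd(2) V _ d])
       (use incl_in[OF p cv] normal_in[OF p] w in \<open>simp_all add: frame_map_def w_eq\<close>)
  with cv have ex: "?P (coord_vector M c p u, a0, b0)" by simp
  have uniq: "z = (coord_vector M c p u, a0, b0)" if z: "?P z" for z
  proof -
    obtain X1 a1 b1 where z_eq: "z = (X1, a1, b1)" by (cases z) auto
    have X1: "X1 \<in> tangent_space M p" and V1: "V = incl M N p X1 + a1 *\<^sub>R N1 p + b1 *\<^sub>R N2 p"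
      using z by (simp_all add: z_eq)
    have V0: "V = incl M N p (coord_vector M c p u) + a0 *\<^sub>R N1 p + b0 *\<^sub>R N2 p"
      using ex by simp
    have ab: "a1 = a0" "b1 = b0"
      using coeffs_eq[OF p X1 V1] coeffs_eq[OF p cv V0] by simp_all
    with V0 V1 have "incl M N p X1 = incl M N p (coord_vector M c p u)" by simp
    then have "X1 = coord_vector M c p u"
      using submanifoldD(5)[OF sub p] cv X1 by (auto dest: inj_onD)
    with ab show ?thesis by (simp add: z_eq)
  qed
  have "?P (decomposition M N p (N1 p) (N2 p) V)"
    unfolding decomposition_def by (rule theI[of ?P, OF ex uniq])
  then show "X \<in> tangent_space M p" "V = incl M N p X + a *\<^sub>R N1 p + b *\<^sub>R N2 p"
    unfolding X_def a_def b_def tangential_part_def normal_coeff1_def normal_coeff2_def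
    by (cases "decomposition M N p (N1 p) (N2 p) V"; simp)+
qed

lemma smooth_on_decomposition:
  assumes c: "c \<in> atlas M" and W: "smooth_section N c W"
  defines "p \<equiv> \<lambda>x. chart_inv c x"
  shows "smooth_on (snd c ` fst c) (\<lambda>x. tangential_part M N (p x) (N1 (p x)) (N2 (p x)) (W (p x)) c)" (is "smooth_on _ ?X")
    and "smooth_on (snd c ` fst c) (\<lambda>x. normal_coeff1 M N (p x) (N1 (p x)) (N2 (p x)) (W (p x)))" (is "smooth_on _ ?a")
    and "smooth_on (snd c ` fst c) (\<lambda>x. normal_coeff2 M N (p x) (N1 (p x)) (N2 (p x)) (W (p x)))" (is "smooth_on _ ?b")
proof -
  let ?u = "\<lambda>x. (?X x, ?a x, ?b x)"
  have u: "smooth_on (snd c ` fst c) ?u"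
  \<comment> \<open>The three functions mention no ambient chart, but the linear system that they
    solve does; hence the passage to overlaps.\<close>
  proof (rule smooth_on_chart_local[OF sub c])
    fix d assume d: "d \<in> atlas N"
    let ?S = "snd c ` (fst c \<inter> fst d)"
    note op = open_chart_image_overlap[OF sub c d]
    have at: "c \<in> charts_at M (p x)" "d \<in> charts_at N (p x)" "p x \<in> points M" if "x \<in> ?S" for x
      using chart_inv_in[OF sub c that] atlas_charts_atI[OF c] atlas_charts_atI[OF d]
        chart_domain_points(1)[OF sub c] unfolding p_def by blast+
    show "smooth_on ?S ?u"
    proof (rule smooth_on_linear_solution[OF op])
      show "linear (frame_map c d (p x))" "bij (frame_map c d (p x))" if "x \<in> ?S" for x
        using linear_frame_map[OF at(1,2)] bij_frame_map[OF at(1,2)] that by simp_all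
      show "smooth_on ?S (\<lambda>x. frame_map c d (p x) v)" for v
      proof -
        obtain u a b where v: "v = (u, a, b)" by (cases v) auto
        have "smooth_on ?S (\<lambda>x. incl M N (p x) (coord_vector M c (p x) u) d + a *\<^sub>R N1 (p x) d + b *\<^sub>R N2 (p x) d)"
          unfolding p_def
          by (intro smooth_on_add op smooth_on_scaleR smooth_on_const
              smooth_sectionD(2)[OF smooth_section_incl_coord_vector[OF sub c] d]
              smooth_sectionD(2)[OF smooth_section_normal_vector_field[OF sub c normal(1)] d]
              smooth_sectionD(2)[OF smooth_section_normal_vector_field[OF sub c normal(2)] d])
        then show ?thesis by (simp add: frame_map_def v)
      qed
      show "smooth_on ?S (\<lambda>x. W (p x) d)"
        unfolding p_def by (rule smooth_sectionD(2)[OF W d])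
      show "frame_map c d (p x) (?u x) = W (p x) d" if x: "x \<in> ?S" for x
      proof -
        have "W (p x) \<in> tangent_space N (p x)"
          unfolding p_def by (rule smooth_sectionD(1)[OF W chart_inv_in(1)[OF sub c x]])
        note dec = decomposition_props[OF at(3)[OF x] this]
        show ?thesis
          using fun_cong[OF dec(2), of d]
          by (simp add: frame_map_def tangent_vector_eq_coord_vector[OF mfd(1) dec(1) at(1)[OF x]])
      qed
    qed
  qed
  note op = open_chart_image[OF mfd(1) c]
  show "smooth_on (snd c ` fst c) ?X"
    using smooth_on_bounded_linear[OF bounded_linear_fst op u] by simp
  have bl: "bounded_linear (\<lambda>z. fst (snd z))" "bounded_linear (\<lambda>z. snd (snd z))"
    by (intro bounded_linear_fst_comp bounded_linear_snd_comp bounded_linear_ident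
        bounded_linear_compose[OF bounded_linear_fst] bounded_linear_compose[OF bounded_linear_snd] bounded_linear_snd)+
  show "smooth_on (snd c ` fst c) ?a" "smooth_on (snd c ` fst c) ?b"
    using smooth_on_bounded_linear[OF bl(1) op u] smooth_on_bounded_linear[OF bl(2) op u] by simp_all
qed

text \<open>For nondegeneracy, a tangent vector orthogonal to all tangent vectors is also orthogonal
  to \<open>N1\<close> and \<open>N2\<close>, hence to every ambient vector by the decomposition.
  Nondegeneracy of \<open>g\<close> and injectivity of the inclusion then apply.\<close>

lemma restrict_metric_pseudo_Riemannian:
  "pseudo_Riemannian_metric M (restrict_metric M N g)"
  unfolding pseudo_Riemannian_metric_def tensor_field_0_2_def
proof (intro conjI ballI allI impI)
  fix p X assume p: "p \<in> points M" and X: "X \<in> tangent_space M p"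
  interpret symmetric_form "tangent_space N p" "g p" by (rule form[OF p])
  note lin = linear_map_onD[OF linear_map_on_incl[OF sub p]]
  show "linear_map_on (tangent_space M p) UNIV (\<lambda>Y. restrict_metric M N g p X Y)"
    "linear_map_on (tangent_space M p) UNIV (\<lambda>Y. restrict_metric M N g p Y X)"
    using X by (simp_all add: linear_map_on_def restrict_metric_def lin)
  show "restrict_metric M N g p X Y = restrict_metric M N g p Y X" if "Y \<in> tangent_space M p" for Y
    using X that form_sym by (simp add: restrict_metric_def lin(1))
  show "X = 0" if *: "\<forall>Y\<in>tangent_space M p. restrict_metric M N g p X Y = 0"
  proof -
    have "g p (incl M N p X) V = 0" if V: "V \<in> tangent_space N p" for V
    proof -
      obtain Y a b where Y: "Y \<in> tangent_space M p" and V_eq: "V = incl M N p Y + a *\<^sub>R N1 p + b *\<^sub>R N2 p"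
        using decomposition_props[OF p V] by blast
      have "g p (incl M N p X) (incl M N p Y) = 0" using * Y by (simp add: restrict_metric_def)
      then show ?thesis
        using lin(1)[OF X] lin(1)[OF Y] normal_in[OF p] normal_in(3,4)[OF p X]
        by (simp add: V_eq form_sym[of "incl M N p X" "N1 p"] form_sym[of "incl M N p X" "N2 p"])
    qed
    then have "incl M N p X = 0"
      using metric points_ambient[OF p] lin(1)[OF X] by (simp add: pseudo_Riemannian_metric_def)
    also have "0 = incl M N p 0"
      using linear_map_on_zero[OF subspace_tangent_space[OF mfd(1)] linear_map_on_incl[OF sub p]] by simp
    finally show "X = 0"
      using submanifoldD(5)[OF sub p] X subspace_0[OF subspace_tangent_space[OF mfd(1)]]
      by (auto dest: inj_onD)
  qed
next
  fix c u w assume c: "c \<in> atlas M"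
  show "smooth_on (snd c ` fst c) (\<lambda>x. restrict_metric M N g (chart_inv c x)
     (coord_vector M c (chart_inv c x) u) (coord_vector M c (chart_inv c x) w))"
    unfolding restrict_metric_def
    by (intro smooth_on_metric[OF sub c metric, of "\<lambda>p. incl M N p (coord_vector M c p _)"
          "\<lambda>p. incl M N p (coord_vector M c p _)"] smooth_section_incl_coord_vector[OF sub c])
qed

end


section \<open>The induced structure\<close>

theorem mainTheorem2:
  fixes Mbar :: "('a, 'e::euclidean_space) manifold"
    and M :: "('a, 'f::euclidean_space) manifold"
    and n :: nat
    and \<phi>bar :: "'a \<Rightarrow> ('a, 'e) tangent_vector \<Rightarrow> ('a, 'e) tangent_vector"
    and \<xi>bar :: "'a \<Rightarrow> ('a, 'e) tangent_vector"
    and \<eta>bar :: "'a \<Rightarrow> ('a, 'e) tangent_vector \<Rightarrow> real"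
    and g :: "'a \<Rightarrow> ('a, 'e) tangent_vector \<Rightarrow> ('a, 'e) tangent_vector \<Rightarrow> real"
    and N1 N2 :: "'a \<Rightarrow> ('a, 'e) tangent_vector"
    and \<xi>0 \<xi>1 \<xi>2 \<xi> :: "'a \<Rightarrow> ('a, 'f) tangent_vector"
    and \<eta>0 \<eta>1 \<eta>2 \<eta> :: "'a \<Rightarrow> ('a, 'f) tangent_vector \<Rightarrow> real"
    and \<phi>0 \<phi> :: "'a \<Rightarrow> ('a, 'f) tangent_vector \<Rightarrow> ('a, 'f) tangent_vector"
    and t0 t2 :: "'a \<Rightarrow> real"
  assumes ambient: "almost_contact_Norden_manifold (n + 1) Mbar \<phi>bar \<xi>bar \<eta>bar g"
    and dim_ambient: "DIM('e) = 2 * n + 3"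
    and submanifold: "submanifold M Mbar"
    and codimension: "DIM('e) = DIM('f) + 2"
    and N1: "normal_vector_field M Mbar g N1"
    and N2: "normal_vector_field M Mbar g N2"
    and spanning: "\<forall>p\<in>points M. span {N1 p, N2 p} = normal_space_at M Mbar g p"
    and i: "\<forall>p\<in>points M. g p (N1 p) (N1 p) = 1 \<and> g p (N2 p) (N2 p) = - 1 \<and> g p (N1 p) (N2 p) = 0"
    and ii: "\<forall>p\<in>points M. \<forall>V\<in>{N1 p, N2 p}. \<forall>W\<in>{N1 p, N2 p}. g p V (\<phi>bar p W) = 0"
    and iii: "\<forall>p\<in>points M. \<forall>W\<in>normal_space_at M Mbar g p. g p W (\<xi>bar p) = 0"
    and \<xi>0: "\<And>p. \<xi>0 p = tangential_part M Mbar p (N1 p) (N2 p) (\<xi>bar p)"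
    and \<phi>0: "\<And>p X. \<phi>0 p X = tangential_part M Mbar p (N1 p) (N2 p) (\<phi>bar p (incl M Mbar p X))"
    and \<eta>1: "\<And>p X. \<eta>1 p X = normal_coeff1 M Mbar p (N1 p) (N2 p) (\<phi>bar p (incl M Mbar p X))"
    and \<eta>2: "\<And>p X. \<eta>2 p X = normal_coeff2 M Mbar p (N1 p) (N2 p) (\<phi>bar p (incl M Mbar p X))"
    and \<xi>1: "\<And>p. \<xi>1 p = tangential_part M Mbar p (N1 p) (N2 p) (\<phi>bar p (N1 p))"
    and \<xi>2: "\<And>p. \<xi>2 p = - tangential_part M Mbar p (N1 p) (N2 p) (\<phi>bar p (N2 p))"
    and \<eta>0: "\<And>p X. \<eta>0 p X = restrict_metric M Mbar g p X (\<xi>0 p)"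
    and t0: "smooth_function M t0"
    and t2: "smooth_function M t2"
    and t0_t2: "\<forall>p\<in>points M. (t0 p)\<^sup>2 + (t2 p)\<^sup>2 = 1"
    and \<xi>: "\<And>p. \<xi> p = t0 p *\<^sub>R \<xi>0 p - t2 p *\<^sub>R \<xi>2 p"
    and \<eta>: "\<And>p X. \<eta> p X = t0 p * \<eta>0 p X - t2 p * \<eta>2 p X"
    and \<phi>: "\<And>p X. \<phi> p X = \<phi>0 p X
               + t0 p *\<^sub>R (\<eta>1 p X *\<^sub>R \<xi>2 p + \<eta>2 p X *\<^sub>R \<xi>1 p)
               + t2 p *\<^sub>R (\<eta>0 p X *\<^sub>R \<xi>1 p + \<eta>1 p X *\<^sub>R \<xi>0 p)"
  shows "almost_contact_Norden_manifold n M \<phi> \<xi> \<eta> (restrict_metric M Mbar g)"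
proof -
  have amb: "smooth_manifold Mbar" "almost_contact_structure Mbar \<phi>bar \<xi>bar \<eta>bar"
    "Norden_metric Mbar \<phi>bar \<eta>bar g"
    using ambient by (simp_all add: almost_contact_Norden_manifold_def)
  have acs: "tensor_field_1_1 Mbar \<phi>bar" "vector_field Mbar \<xi>bar" "one_form Mbar \<eta>bar"
    using amb(2) by (simp_all add: almost_contact_structure_def)
  interpret framed_submanifold M Mbar g N1 N2
    using submanifold codimension amb(3) N1 N2 i by unfold_locales (simp_all add: Norden_metric_def)
  have frame: "framed_subspace (tangent_space Mbar p) (g p) (\<phi>bar p) (\<xi>bar p) (\<eta>bar p)
      (tangent_space M p) (incl M Mbar p) (N1 p) (N2 p) (tangential_part M Mbar p (N1 p) (N2 p))
      (normal_coeff1 M Mbar p (N1 p) (N2 p)) (normal_coeff2 M Mbar p (N1 p) (N2 p))"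
    if p: "p \<in> points M" for p
  proof -
    note pN = points_ambient[OF p]
    interpret symmetric_form "tangent_space Mbar p" "g p" by (rule form[OF p])
    have normal_at: "N1 p \<in> normal_space_at M Mbar g p" "N2 p \<in> normal_space_at M Mbar g p"
      using N1 N2 p by (simp_all add: normal_vector_field_def)
    note N_in = normal_in(1,2)[OF p]
    show ?thesis
    proof
      show "linear_map_on (tangent_space Mbar p) (tangent_space Mbar p) (\<phi>bar p)"
        using acs(1) pN by (simp add: tensor_field_1_1_def)
      show "\<xi>bar p \<in> tangent_space Mbar p"
        using acs(2) pN by (simp add: vector_field_def)
      show "linear_map_on (tangent_space Mbar p) UNIV (\<eta>bar p)"
        using acs(3) pN by (simp add: one_form_def)
      show "\<phi>bar p (\<phi>bar p X) = - X + \<eta>bar p X *\<^sub>R \<xi>bar p" if "X \<in> tangent_space Mbar p" for X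
        using amb(2) pN that unfolding almost_contact_structure_def by blast
      show "\<eta>bar p (\<xi>bar p) = 1"
        using amb(2) pN unfolding almost_contact_structure_def by blast
      show "g p (\<phi>bar p X) (\<phi>bar p Y) = - g p X Y + \<eta>bar p X * \<eta>bar p Y"
        if "X \<in> tangent_space Mbar p" "Y \<in> tangent_space Mbar p" for X Y
        using amb(3) pN that unfolding Norden_metric_def by blast
      show "subspace (tangent_space M p)" by (rule subspace_tangent_space[OF mfd(1)])
      show "linear_map_on (tangent_space M p) (tangent_space Mbar p) (incl M Mbar p)"
        by (rule linear_map_on_incl[OF submanifold p])
      show "inj_on (incl M Mbar p) (tangent_space M p)" by (rule submanifoldD(5)[OF submanifold p])
      show "g p (incl M Mbar p X) (N1 p) = 0" "g p (incl M Mbar p X) (N2 p) = 0"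
        if "X \<in> tangent_space M p" for X
        using normal_in(3,4)[OF p that] form_sym[OF incl_in[OF p that] N_in(1)]
          form_sym[OF incl_in[OF p that] N_in(2)] by simp_all
      show "g p (N1 p) (\<xi>bar p) = 0" "g p (N2 p) (\<xi>bar p) = 0"
        using iii p normal_at by simp_all
      show "g p (N1 p) (\<phi>bar p (N1 p)) = 0" "g p (N1 p) (\<phi>bar p (N2 p)) = 0"
        "g p (N2 p) (\<phi>bar p (N1 p)) = 0" "g p (N2 p) (\<phi>bar p (N2 p)) = 0"
        using ii p by simp_all
    qed (use N_in orthonormal[OF p] decomposition_props[OF p] in simp_all)
  qed
  have pointwise: "\<xi> p \<in> tangent_space M p" "linear_map_on (tangent_space M p) (tangent_space M p) (\<phi> p)"
      "linear_map_on (tangent_space M p) UNIV (\<eta> p)" "\<eta> p (\<xi> p) = 1"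
      "X \<in> tangent_space M p \<Longrightarrow> \<phi> p (\<phi> p X) = - X + \<eta> p X *\<^sub>R \<xi> p"
      "X \<in> tangent_space M p \<Longrightarrow> Y \<in> tangent_space M p \<Longrightarrow>
        restrict_metric M Mbar g p (\<phi> p X) (\<phi> p Y) = - restrict_metric M Mbar g p X Y + \<eta> p X * \<eta> p Y"
      "incl M Mbar p (\<xi>0 p) = \<xi>bar p"
    if p: "p \<in> points M" for p X Y
  proof -
    interpret P: framed_subspace "tangent_space Mbar p" "g p" "\<phi>bar p" "\<xi>bar p" "\<eta>bar p"
      "tangent_space M p" "incl M Mbar p" "N1 p" "N2 p" "tangential_part M Mbar p (N1 p) (N2 p)"
      "normal_coeff1 M Mbar p (N1 p) (N2 p)" "normal_coeff2 M Mbar p (N1 p) (N2 p)"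
      by (rule frame[OF p])
    have t: "(t0 p)\<^sup>2 + (t2 p)\<^sup>2 = 1" using t0_t2 p by simp
    have h: "restrict_metric M Mbar g p = P.ind_h"
      by (simp add: restrict_metric_def P.ind_h_def fun_eq_iff)
    have z: "\<xi>0 p = P.ind_z0" "\<xi>1 p = P.ind_z1" "\<xi>2 p = P.ind_z2"
      by (simp_all add: \<xi>0 \<xi>1 \<xi>2 P.ind_z0_def P.ind_z1_def P.ind_z2_def)
    have \<xi>_eq: "\<xi> p = P.induced.zt (t0 p) (t2 p)"
      by (simp add: \<xi> z P.induced.zt_def)
    \<comment> \<open>The restriction to tangent vectors comes from \<open>P.normal_coeffs\<close>,
      which identifies the normal coefficients only there; linearity on the tangent space is
      transferred under the same restriction.\<close>
    have \<eta>_eq: "\<eta> p X = P.induced.et (t0 p) (t2 p) X" if "X \<in> tangent_space M p" for X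
      by (simp add: \<eta> \<eta>0 \<eta>2 h z P.induced.et_def P.normal_coeffs[OF that])
    have \<phi>_eq: "\<phi> p X = P.induced.Ft (t0 p) (t2 p) X" if "X \<in> tangent_space M p" for X
      by (simp add: \<phi> \<phi>0 \<eta>0 \<eta>1 \<eta>2 h z P.induced.Ft_def P.normal_coeffs[OF that] P.ind_F_def)
    show "\<xi> p \<in> tangent_space M p" by (simp add: \<xi>_eq)
    show "linear_map_on (tangent_space M p) (tangent_space M p) (\<phi> p)"
      using P.induced.linear_map_on_Ft by (simp add: linear_map_on_def \<phi>_eq)
    show "linear_map_on (tangent_space M p) UNIV (\<eta> p)"
      using P.induced.linear_map_on_et by (simp add: linear_map_on_def \<eta>_eq)
    show "\<eta> p (\<xi> p) = 1"
      using P.induced.et_zt[OF t] by (simp add: \<eta>_eq \<xi>_eq)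
    show "\<phi> p (\<phi> p X) = - X + \<eta> p X *\<^sub>R \<xi> p" if "X \<in> tangent_space M p"
      using P.induced.Ft_Ft[OF that t] that by (simp add: \<phi>_eq \<eta>_eq \<xi>_eq)
    show "restrict_metric M Mbar g p (\<phi> p X) (\<phi> p Y) =
        - restrict_metric M Mbar g p X Y + \<eta> p X * \<eta> p Y"
      if "X \<in> tangent_space M p" "Y \<in> tangent_space M p"
      using P.induced.Ft_norden[OF that t] that by (simp add: \<phi>_eq \<eta>_eq h)
    show "incl M Mbar p (\<xi>0 p) = \<xi>bar p" by (simp add: z P.iota_z)
  qed
  have smooth: "smooth_on (snd c ` fst c) (\<lambda>x. \<xi> (chart_inv c x) c)"
      "smooth_on (snd c ` fst c) (\<lambda>x. \<eta> (chart_inv c x) (coord_vector M c (chart_inv c x) u))"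
      "smooth_on (snd c ` fst c) (\<lambda>x. \<phi> (chart_inv c x) (coord_vector M c (chart_inv c x) u) c)"
    if c: "c \<in> atlas M" for c u
  proof -
    let ?S = "snd c ` fst c"
    let ?u = "\<lambda>x. coord_vector M c (chart_inv c x) u"
    note op = open_chart_image[OF mfd(1) c]
    note section_incl = smooth_section_incl_coord_vector[OF submanifold c, of u]
    note section_\<xi> = smooth_section_vector_field[OF submanifold c acs(2)]
    note section_N = smooth_section_normal_vector_field[OF submanifold c N1]
      smooth_section_normal_vector_field[OF submanifold c N2]
    note section_\<phi> = smooth_section_tensor[OF submanifold c acs(1)]
    have t: "smooth_on ?S (\<lambda>x. t0 (chart_inv c x))" "smooth_on ?S (\<lambda>x. t2 (chart_inv c x))"
      using t0 t2 c by (simp_all add: smooth_function_def o_def)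
    have z: "smooth_on ?S (\<lambda>x. \<xi>0 (chart_inv c x) c)" "smooth_on ?S (\<lambda>x. \<xi>1 (chart_inv c x) c)"
      unfolding \<xi>0 \<xi>1
      by (rule smooth_on_decomposition(1)[OF c section_\<xi>],
          rule smooth_on_decomposition(1)[OF c section_\<phi>[OF section_N(1)]])
    have z2: "smooth_on ?S (\<lambda>x. \<xi>2 (chart_inv c x) c)"
      using smooth_on_minus[OF op smooth_on_decomposition(1)[OF c section_\<phi>[OF section_N(2)]]]
      by (simp add: \<xi>2)
    have f: "smooth_on ?S (\<lambda>x. \<phi>0 (chart_inv c x) (?u x) c)"
      "smooth_on ?S (\<lambda>x. \<eta>1 (chart_inv c x) (?u x))" "smooth_on ?S (\<lambda>x. \<eta>2 (chart_inv c x) (?u x))"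
      unfolding \<phi>0 \<eta>1 \<eta>2
      by (rule smooth_on_decomposition[OF c section_\<phi>[OF section_incl]])+
    \<comment> \<open>\<open>\<eta>0\<close> pairs with the included vector of
      \<open>\<xi>0\<close>, which \<open>pointwise(7)\<close> identifies with the ambient
      \<open>\<xi>bar\<close>. That is a smooth section, so \<open>smooth_on_metric\<close>
      applies.\<close>
    have e0: "smooth_on ?S (\<lambda>x. \<eta>0 (chart_inv c x) (?u x))"
    proof (rule smooth_on_cong[OF op _ smooth_on_metric[OF submanifold c metric section_incl section_\<xi>]])
      fix x assume "x \<in> ?S"
      then have "chart_inv c x \<in> points M"
        using chart_inv_in(1)[OF submanifold c, of x UNIV] chart_domain_points(1)[OF submanifold c] by simp
      then show "g (chart_inv c x) (incl M Mbar (chart_inv c x) (?u x)) (\<xi>bar (chart_inv c x)) =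
          \<eta>0 (chart_inv c x) (?u x)"
        by (simp add: \<eta>0 restrict_metric_def pointwise(7))
    qed
    show "smooth_on ?S (\<lambda>x. \<xi> (chart_inv c x) c)"
      unfolding \<xi> fun_diff_def scaleR_fun_apply
      by (intro smooth_on_diff smooth_on_scaleR op t z z2)
    show "smooth_on ?S (\<lambda>x. \<eta> (chart_inv c x) (?u x))"
      unfolding \<eta> by (intro smooth_on_diff smooth_on_mult op t f e0)
    show "smooth_on ?S (\<lambda>x. \<phi> (chart_inv c x) (?u x) c)"
      unfolding \<phi> plus_fun_apply scaleR_fun_apply
      by (intro smooth_on_add smooth_on_scaleR op t z z2 f e0)
  qed
  have "almost_contact_structure M \<phi> \<xi> \<eta>"
    unfolding almost_contact_structure_def tensor_field_1_1_def vector_field_def one_form_def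
    using pointwise(1-5) smooth by blast
  moreover have "Norden_metric M \<phi> \<eta> (restrict_metric M Mbar g)"
    unfolding Norden_metric_def using restrict_metric_pseudo_Riemannian pointwise(6) by blast
  moreover have "DIM('f) = 2 * n + 1"
    using codimension dim_ambient by simp
  ultimately show ?thesis
    using mfd(1) by (simp add: almost_contact_Norden_manifold_def)
qed

end
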